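(* Let $\alpha=\alpha(t)$ and $\beta=\beta(t)$, and let $u$ be the solution of $u''+\beta(t)Au'+\alpha(t)u'+Au=0$ in $\Omega\times(0,\infty)$, $u=0$ on $\partial\Omega\times[0,\infty)$, $u(0)=u_0$, $u'(0)=u_1$. Then, under the assumption that $$0<\alpha_{\min}\le\alpha(t)\le\alpha_{\max},\quad0<\beta_{\min}\le\beta(t)\le\beta_{\max},\quad\alpha'(t)\ge0,\quad\beta'(t)\ge0,\qquad\forall\,t\in[0,\infty),$$ the following results hold for $u_0\in D(A^{j})$ and $u_1\in D(A^{j-\frac12})$ with $j\ge\frac12$: (i) if $0<\delta<\min\left(\frac{\alpha_{\min}+\beta_{\min}\lambda_1}{2},\frac{\lambda_1}{\alpha_{\max}+\beta_{\max}\lambda_1}\right)$ or $0<\delta=\frac{\alpha_{\min}+\beta_{\min}\lambda_1}{2}$, then $$E_{A^{(j)}}(u)(t)\le C(\alpha,\beta,\lambda_1)\,e^{-2\delta t}E_{A^{(j)}}(u)(0),$$ where $E_{A^{(j)}}(u)(t)=\frac12\left(|u'(t)|_{2j-1}^2+|u(t)|_{2j}^2\right)$; (ii) if $0<\delta=\frac{\lambda_1}{\alpha_{\max}+\beta_{\max}\lambda_1}$, then $$|u'(t)|_{2j-1}^2\le C\,e^{-2\delta t}E_{A^{(j)}}(u)(0).$$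
   Context: $\Omega\subset\mathbb{R}^d$ is a bounded domain, $\|\cdot\|$ and $(\cdot,\cdot)$ are the norm and inner product of $L^2(\Omega)$, and $A=-\Delta$ with domain $D(A)=H^2(\Omega)\cap H_0^1(\Omega)$ is self-adjoint and positive definite on $L^2(\Omega)$; $\lambda_1>0$ is its smallest eigenvalue. For $s\ge 0$, $|v|_s=\|A^{s/2}v\|$ (so $|v|_0=\|v\|$). Set $a(w,v)=(A^{1/2}w,A^{1/2}v)$. Primes denote time derivatives. The solution is understood in the variational sense: $u(t)\in H_0^1(\Omega)$ with $(u'',v)+\beta(t)a(u',v)+\alpha(t)(u',v)+a(u,v)=0$ for all $v\in H_0^1(\Omega)$, $t>0$, and $u(0)=u_0$, $u'(0)=u_1$. $C$ and $C(\alpha,\beta,\lambda_1)$ denote positive constants independent of $t$ and of the initial data; the estimates are for $t\ge0$.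
   Formalization: The equality cases are read as endpoints of the minimum: in (i) δ=(α_min+β_minλ₁)/2 is also required to be ≤ λ₁/(α_max+β_maxλ₁), and in (ii) δ=λ₁/(α_max+β_maxλ₁) to be ≤ (α_min+β_minλ₁)/2; without this both fail for constant α, β. *)

theory Defs
  imports "HOL-Analysis.Analysis"
begin

section \<open>The space of square integrable functions on a domain\<close>

text \<open>Elements of the Lebesgue space are represented by functions; all notions below are invariant
  under changing a function on a null set of the domain.\<close>

definition bounded_domain :: "'a::euclidean_space set \<Rightarrow> bool" where
  "bounded_domain \<Omega> \<longleftrightarrow> open \<Omega> \<and> connected \<Omega> \<and> bounded \<Omega> \<and> \<Omega> \<noteq> {}"

definition L2 :: "'a::euclidean_space set \<Rightarrow> ('a \<Rightarrow> real) set" where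
  "L2 \<Omega> = {f. f \<in> borel_measurable (lebesgue_on \<Omega>) \<and> integrable (lebesgue_on \<Omega>) (\<lambda>x. (f x)\<^sup>2)}"

definition L2_inner :: "'a::euclidean_space set \<Rightarrow> ('a \<Rightarrow> real) \<Rightarrow> ('a \<Rightarrow> real) \<Rightarrow> real" where
  "L2_inner \<Omega> f g = (\<integral>x. f x * g x \<partial>lebesgue_on \<Omega>)"

definition L2_norm :: "'a::euclidean_space set \<Rightarrow> ('a \<Rightarrow> real) \<Rightarrow> real" where
  "L2_norm \<Omega> f = sqrt (L2_inner \<Omega> f f)"

section \<open>Sobolev spaces\<close>

definition partial_deriv :: "'a::euclidean_space \<Rightarrow> ('a \<Rightarrow> real) \<Rightarrow> 'a \<Rightarrow> real" where
  "partial_deriv b f x = frechet_derivative f (at x) b"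

primrec cont_diff :: "nat \<Rightarrow> ('a::euclidean_space \<Rightarrow> real) \<Rightarrow> bool" where
  "cont_diff 0 f = continuous_on UNIV f"
| "cont_diff (Suc k) f =
    ((\<forall>x. f differentiable (at x)) \<and> (\<forall>b\<in>Basis. cont_diff k (partial_deriv b f)))"

definition test_functions :: "'a::euclidean_space set \<Rightarrow> ('a \<Rightarrow> real) set" where
  "test_functions \<Omega> = {\<psi>. (\<forall>k. cont_diff k \<psi>) \<and> compact (closure {x. \<psi> x \<noteq> 0})
      \<and> closure {x. \<psi> x \<noteq> 0} \<subseteq> \<Omega>}"

definition weak_partial ::
  "'a::euclidean_space set \<Rightarrow> 'a \<Rightarrow> ('a \<Rightarrow> real) \<Rightarrow> ('a \<Rightarrow> real) \<Rightarrow> bool" where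
  "weak_partial \<Omega> b v g \<longleftrightarrow>
    (\<forall>\<psi>\<in>test_functions \<Omega>. L2_inner \<Omega> v (partial_deriv b \<psi>) = - L2_inner \<Omega> g \<psi>)"

definition weak_gradient ::
  "'a::euclidean_space set \<Rightarrow> ('a \<Rightarrow> real) \<Rightarrow> ('a \<Rightarrow> 'a \<Rightarrow> real) \<Rightarrow> bool" where
  "weak_gradient \<Omega> v g \<longleftrightarrow> (\<forall>b\<in>Basis. g b \<in> L2 \<Omega> \<and> weak_partial \<Omega> b v (g b))"

text \<open>The closure of the test functions in the first-order Sobolev space.\<close>

definition H10 :: "'a::euclidean_space set \<Rightarrow> ('a \<Rightarrow> real) set" where
  "H10 \<Omega> = {v \<in> L2 \<Omega>. \<exists>g. weak_gradient \<Omega> v g \<and>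
      (\<exists>\<psi>. (\<forall>n::nat. \<psi> n \<in> test_functions \<Omega>) \<and>
           (\<lambda>n. L2_norm \<Omega> (\<lambda>x. v x - \<psi> n x)) \<longlonglongrightarrow> 0 \<and>
           (\<forall>b\<in>Basis. (\<lambda>n. L2_norm \<Omega> (\<lambda>x. g b x - partial_deriv b (\<psi> n) x)) \<longlonglongrightarrow> 0))}"

definition weak_grad_hess :: "'a::euclidean_space set \<Rightarrow> ('a \<Rightarrow> real) \<Rightarrow> ('a \<Rightarrow> 'a \<Rightarrow> real)
    \<Rightarrow> ('a \<Rightarrow> 'a \<Rightarrow> 'a \<Rightarrow> real) \<Rightarrow> bool" where
  "weak_grad_hess \<Omega> v g h \<longleftrightarrow>
    weak_gradient \<Omega> v g \<and> (\<forall>b\<in>Basis. weak_gradient \<Omega> (g b) (h b))"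

definition H2 :: "'a::euclidean_space set \<Rightarrow> ('a \<Rightarrow> real) set" where
  "H2 \<Omega> = {v \<in> L2 \<Omega>. \<exists>g h. weak_grad_hess \<Omega> v g h}"

section \<open>The Dirichlet Laplacian\<close>

text \<open>The graph of the operator: the second argument is mapped to the third one, and the domain
  consists of the functions in both H2 and H10.\<close>

definition lapA :: "'a::euclidean_space set \<Rightarrow> ('a \<Rightarrow> real) \<Rightarrow> ('a \<Rightarrow> real) \<Rightarrow> bool" where
  "lapA \<Omega> v f \<longleftrightarrow> v \<in> H2 \<Omega> \<inter> H10 \<Omega> \<and> f \<in> L2 \<Omega> \<and>
    (\<exists>g h. weak_grad_hess \<Omega> v g h \<and>
       (AE x in lebesgue_on \<Omega>. f x = - (\<Sum>b\<in>Basis. h b b x)))"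

text \<open>Density of the domain, and equality of the graph with that of the adjoint operator.\<close>

definition lapA_self_adjoint :: "'a::euclidean_space set \<Rightarrow> bool" where
  "lapA_self_adjoint \<Omega> \<longleftrightarrow>
    (\<forall>v\<in>L2 \<Omega>. \<forall>\<epsilon>>0. \<exists>w\<in>H2 \<Omega> \<inter> H10 \<Omega>. L2_norm \<Omega> (\<lambda>x. v x - w x) < \<epsilon>) \<and>
    (\<forall>w\<in>L2 \<Omega>. \<forall>f\<in>L2 \<Omega>.
       (\<forall>v g. lapA \<Omega> v g \<longrightarrow> L2_inner \<Omega> g w = L2_inner \<Omega> v f) \<longleftrightarrow> lapA \<Omega> w f)"

definition lapA_pos_def :: "'a::euclidean_space set \<Rightarrow> bool" where
  "lapA_pos_def \<Omega> \<longleftrightarrow>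
    (\<forall>v f. lapA \<Omega> v f \<and> L2_norm \<Omega> v \<noteq> 0 \<longrightarrow> L2_inner \<Omega> f v > 0)"

definition eigenpair :: "'a::euclidean_space set \<Rightarrow> real \<Rightarrow> ('a \<Rightarrow> real) \<Rightarrow> bool" where
  "eigenpair \<Omega> \<mu> \<phi> \<longleftrightarrow> lapA \<Omega> \<phi> (\<lambda>x. \<mu> * \<phi> x) \<and> L2_norm \<Omega> \<phi> \<noteq> 0"

definition eigenvalue_of :: "'a::euclidean_space set \<Rightarrow> ('a \<Rightarrow> real) \<Rightarrow> real" where
  "eigenvalue_of \<Omega> \<phi> = (THE \<mu>. eigenpair \<Omega> \<mu> \<phi>)"

definition smallest_eigenvalue :: "'a::euclidean_space set \<Rightarrow> real \<Rightarrow> bool" where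
  "smallest_eigenvalue \<Omega> \<mu> \<longleftrightarrow>
    (\<exists>\<phi>. eigenpair \<Omega> \<mu> \<phi>) \<and> (\<forall>\<nu> \<phi>. eigenpair \<Omega> \<nu> \<phi> \<longrightarrow> \<mu> \<le> \<nu>)"

section \<open>Fractional powers\<close>

text \<open>Fractional powers are given by the spectral decomposition.  On a bounded domain the resolvent
  is compact, so for a self-adjoint Dirichlet Laplacian a maximal orthonormal system of
  eigenfunctions is an orthonormal basis of the whole Lebesgue space, and the powers do not depend
  on which one is chosen.  In particular the power with exponent 0 is the identity.\<close>

definition eigensystem :: "'a::euclidean_space set \<Rightarrow> ('a \<Rightarrow> real) set \<Rightarrow> bool" where
  "eigensystem \<Omega> B \<longleftrightarrow> (\<forall>\<phi>\<in>B. \<exists>\<mu>. eigenpair \<Omega> \<mu> \<phi>) \<and>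
    (\<forall>\<phi>\<in>B. \<forall>\<psi>\<in>B. L2_inner \<Omega> \<phi> \<psi> = (if \<phi> = \<psi> then 1 else 0))"

definition eigenbasis :: "'a::euclidean_space set \<Rightarrow> ('a \<Rightarrow> real) set" where
  "eigenbasis \<Omega> =
    (SOME B. eigensystem \<Omega> B \<and> (\<forall>B'. eigensystem \<Omega> B' \<and> B \<subseteq> B' \<longrightarrow> B' = B))"

text \<open>The graph of the power with exponent s: the eigenfunction expansion of the image converges
  unconditionally in the L2 norm.\<close>

definition powA_graph ::
  "'a::euclidean_space set \<Rightarrow> real \<Rightarrow> ('a \<Rightarrow> real) \<Rightarrow> ('a \<Rightarrow> real) \<Rightarrow> bool" where
  "powA_graph \<Omega> s v w \<longleftrightarrow> v \<in> L2 \<Omega> \<and> w \<in> L2 \<Omega> \<and>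
    ((\<lambda>F. L2_norm \<Omega> (\<lambda>x. w x - (\<Sum>\<phi>\<in>F. eigenvalue_of \<Omega> \<phi> powr s * L2_inner \<Omega> v \<phi> * \<phi> x)))
      \<longlongrightarrow> 0) (finite_subsets_at_top (eigenbasis \<Omega>))"

definition dom_powA :: "'a::euclidean_space set \<Rightarrow> real \<Rightarrow> ('a \<Rightarrow> real) set" where
  "dom_powA \<Omega> s = {v. \<exists>w. powA_graph \<Omega> s v w}"

text \<open>The image is unique up to null sets; some representative is chosen.\<close>

definition powA :: "'a::euclidean_space set \<Rightarrow> real \<Rightarrow> ('a \<Rightarrow> real) \<Rightarrow> ('a \<Rightarrow> real)" where
  "powA \<Omega> s v = (SOME w. powA_graph \<Omega> s v w)"

definition normA :: "'a::euclidean_space set \<Rightarrow> real \<Rightarrow> ('a \<Rightarrow> real) \<Rightarrow> real" where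
  "normA \<Omega> s v = L2_norm \<Omega> (powA \<Omega> (s / 2) v)"

definition formA :: "'a::euclidean_space set \<Rightarrow> ('a \<Rightarrow> real) \<Rightarrow> ('a \<Rightarrow> real) \<Rightarrow> real" where
  "formA \<Omega> w v = L2_inner \<Omega> (powA \<Omega> (1/2) w) (powA \<Omega> (1/2) v)"

section \<open>Variational solutions and their energy\<close>

text \<open>Differentiability on [0,\<infinity>) as a map into the Lebesgue space (one-sided at 0).\<close>

definition L2_time_deriv ::
  "'a::euclidean_space set \<Rightarrow> (real \<Rightarrow> 'a \<Rightarrow> real) \<Rightarrow> (real \<Rightarrow> 'a \<Rightarrow> real) \<Rightarrow> bool" where
  "L2_time_deriv \<Omega> u u' \<longleftrightarrow> (\<forall>t\<ge>0. u t \<in> L2 \<Omega> \<and> u' t \<in> L2 \<Omega> \<and>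
     ((\<lambda>s. L2_norm \<Omega> (\<lambda>x. (u s x - u t x) / (s - t) - u' t x)) \<longlongrightarrow> 0) (at t within {0..}))"

text \<open>Here \<open>u'\<close> is the time derivative of \<open>u\<close>. The second derivative only enters
  through its pairing with a fixed \<open>v\<close>, which is the derivative \<open>d\<close> of the pairing of \<open>u'\<close> with \<open>v\<close>;
  so the second derivative need not take values in the Lebesgue space.\<close>

definition variational_solution :: "'a::euclidean_space set \<Rightarrow> (real \<Rightarrow> real) \<Rightarrow> (real \<Rightarrow> real)
    \<Rightarrow> ('a \<Rightarrow> real) \<Rightarrow> ('a \<Rightarrow> real) \<Rightarrow> (real \<Rightarrow> 'a \<Rightarrow> real) \<Rightarrow> (real \<Rightarrow> 'a \<Rightarrow> real) \<Rightarrow> bool" where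
  "variational_solution \<Omega> \<alpha> \<beta> u0 u1 u u' \<longleftrightarrow>
    L2_time_deriv \<Omega> u u' \<and>
    (\<forall>t\<ge>0. u t \<in> H10 \<Omega>) \<and> (\<forall>t>0. u' t \<in> H10 \<Omega>) \<and>
    (\<forall>t>0. \<forall>v\<in>H10 \<Omega>. \<exists>d.
       ((\<lambda>s. L2_inner \<Omega> (u' s) v) has_real_derivative d) (at t) \<and>
       d + \<beta> t * formA \<Omega> (u' t) v + \<alpha> t * L2_inner \<Omega> (u' t) v + formA \<Omega> (u t) v = 0) \<and>
    (AE x in lebesgue_on \<Omega>. u 0 x = u0 x) \<and> (AE x in lebesgue_on \<Omega>. u' 0 x = u1 x)"

definition energyA :: "'a::euclidean_space set \<Rightarrow> real \<Rightarrow> (real \<Rightarrow> 'a \<Rightarrow> real)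
    \<Rightarrow> (real \<Rightarrow> 'a \<Rightarrow> real) \<Rightarrow> real \<Rightarrow> real" where
  "energyA \<Omega> j u u' t = 1/2 * ((normA \<Omega> (2*j - 1) (u' t))\<^sup>2 + (normA \<Omega> (2*j) (u t))\<^sup>2)"

end

theory Submission
  imports Defs
begin

text \<open>
  Testing the equation with an eigenfunction of eigenvalue \<open>\<nu>\<close> gives the scalar oscillator
  \<open>y'' + a y' + \<nu> y = 0\<close> with the nondecreasing damping \<open>a = \<alpha> + \<beta> \<nu>\<close>. For \<open>w = e\<^sup>\<delta>\<^sup>t y\<close> the energy
  \<open>w'\<^sup>2 + (\<nu> - a \<delta> + \<delta>\<^sup>2) w\<^sup>2\<close> is nonincreasing when \<open>2 \<delta> \<le> a\<close>, and the bound on \<open>\<delta>\<close> makes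
  \<open>\<nu> - a \<delta> + \<delta>\<^sup>2\<close> comparable to \<open>\<nu>\<close> uniformly in \<open>\<nu>\<close> and \<open>\<delta>\<close>, the term \<open>\<delta>\<^sup>2\<close> taking over where
  \<open>\<nu> - a \<delta>\<close> degenerates. Summing the modes with the weights \<open>\<nu>\<^sup>2\<^sup>j\<^sup>-\<^sup>1\<close> gives (i) for every admissible
  \<open>\<delta>\<close> with a single constant, and this includes (ii). All norms in the statement depend on the
  eigenfunction coefficients only, so completeness of the eigenfunctions in L2 is not needed.
\<close>

section \<open>Square integrable functions\<close>

lemma L2_integrable_mult:
  assumes "f \<in> L2 \<Omega>" "g \<in> L2 \<Omega>"
  shows "integrable (lebesgue_on \<Omega>) (\<lambda>x. f x * g x)"
proof (rule Bochner_Integration.integrable_bound)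
  show "integrable (lebesgue_on \<Omega>) (\<lambda>x. (f x)\<^sup>2 + (g x)\<^sup>2)"
    using assms by (auto simp: L2_def)
  show "(\<lambda>x. f x * g x) \<in> borel_measurable (lebesgue_on \<Omega>)"
    using assms by (auto simp: L2_def)
  have "\<bar>f x * g x\<bar> \<le> (f x)\<^sup>2 + (g x)\<^sup>2" for x
    using sum_squares_bound[of "f x" "g x"] sum_squares_bound[of "f x" "- g x"]
    by (auto simp: abs_if intro: order_trans[rotated])
  then show "AE x in lebesgue_on \<Omega>. norm (f x * g x) \<le> norm ((f x)\<^sup>2 + (g x)\<^sup>2)"
    by (auto intro: order_trans[OF _ abs_ge_self])
qed

lemma L2_zero: "(\<lambda>x. 0) \<in> L2 \<Omega>"
  by (simp add: L2_def)

lemma L2_add: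
  assumes "f \<in> L2 \<Omega>" "g \<in> L2 \<Omega>"
  shows "(\<lambda>x. f x + g x) \<in> L2 \<Omega>"
  using assms L2_integrable_mult[OF assms]
  by (auto simp: L2_def power2_sum mult.assoc)

lemma L2_scale:
  assumes "f \<in> L2 \<Omega>"
  shows "(\<lambda>x. c * f x) \<in> L2 \<Omega>"
  using assms by (auto simp: L2_def power_mult_distrib)

lemma L2_diff:
  assumes "f \<in> L2 \<Omega>" "g \<in> L2 \<Omega>"
  shows "(\<lambda>x. f x - g x) \<in> L2 \<Omega>"
  using L2_add[OF assms(1) L2_scale[OF assms(2), of "-1"]] by simp

lemma L2_sum:
  assumes "\<And>i. i \<in> F \<Longrightarrow> f i \<in> L2 \<Omega>"
  shows "(\<lambda>x. \<Sum>i\<in>F. f i x) \<in> L2 \<Omega>"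
  using assms by (induction F rule: infinite_finite_induct) (auto intro: L2_zero L2_add)

section \<open>The L2 inner product and the Cauchy-Schwarz inequality\<close>

lemma L2_inner_commute: "L2_inner \<Omega> f g = L2_inner \<Omega> g f"
  by (simp add: L2_inner_def mult.commute)

lemma L2_inner_diff_left:
  assumes "f \<in> L2 \<Omega>" "g \<in> L2 \<Omega>" "h \<in> L2 \<Omega>"
  shows "L2_inner \<Omega> (\<lambda>x. f x - g x) h = L2_inner \<Omega> f h - L2_inner \<Omega> g h"
  using assms by (simp add: L2_inner_def left_diff_distrib L2_integrable_mult)

lemma L2_inner_scale_left: "L2_inner \<Omega> (\<lambda>x. c * f x) h = c * L2_inner \<Omega> f h"
  by (simp add: L2_inner_def mult.assoc)

lemma L2_inner_sum_left:
  assumes "\<And>i. i \<in> F \<Longrightarrow> f i \<in> L2 \<Omega>" "h \<in> L2 \<Omega>"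
  shows "L2_inner \<Omega> (\<lambda>x. \<Sum>i\<in>F. f i x) h = (\<Sum>i\<in>F. L2_inner \<Omega> (f i) h)"
  using assms
  by (simp add: L2_inner_def sum_distrib_right L2_integrable_mult Bochner_Integration.integral_sum)

lemma L2_inner_diff_right:
  assumes "f \<in> L2 \<Omega>" "g \<in> L2 \<Omega>" "h \<in> L2 \<Omega>"
  shows "L2_inner \<Omega> h (\<lambda>x. f x - g x) = L2_inner \<Omega> h f - L2_inner \<Omega> h g"
  using L2_inner_diff_left[OF assms] by (simp add: L2_inner_commute)

lemma L2_inner_self_nonneg: "0 \<le> L2_inner \<Omega> f f"
  by (simp add: L2_inner_def)

lemma L2_norm_nonneg: "0 \<le> L2_norm \<Omega> f"
  by (simp add: L2_norm_def L2_inner_self_nonneg)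

lemma L2_norm_power2: "(L2_norm \<Omega> f)\<^sup>2 = L2_inner \<Omega> f f"
  by (simp add: L2_norm_def L2_inner_self_nonneg)

text \<open>The square of the norm of \<open>f - t g\<close> is a nonnegative quadratic in
  \<open>t\<close>. Elements of \<open>L2\<close> are functions, so the form is only semidefinite
  and a \<open>g\<close> of norm zero needs its own case.\<close>

lemma L2_inner_Cauchy_Schwarz:
  assumes f: "f \<in> L2 \<Omega>" and g: "g \<in> L2 \<Omega>"
  shows "\<bar>L2_inner \<Omega> f g\<bar> \<le> L2_norm \<Omega> f * L2_norm \<Omega> g"
proof -
  define a b c where "a = L2_inner \<Omega> f f" and "b = L2_inner \<Omega> f g" and "c = L2_inner \<Omega> g g"
  have q: "0 \<le> a - 2 * t * b + t\<^sup>2 * c" for t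
  proof -
    have tg: "(\<lambda>x. t * g x) \<in> L2 \<Omega>" by (rule L2_scale[OF g])
    have "0 \<le> L2_inner \<Omega> (\<lambda>x. f x - t * g x) (\<lambda>x. f x - t * g x)"
      by (rule L2_inner_self_nonneg)
    also have "\<dots> = a - 2 * t * b + t\<^sup>2 * c"
      by (simp add: L2_inner_diff_left L2_inner_diff_right L2_diff f g tg L2_inner_scale_left
          L2_inner_commute[of \<Omega> _ "\<lambda>x. t * g x"] L2_inner_commute[of \<Omega> g f]
          a_def b_def c_def power2_eq_square algebra_simps)
    finally show ?thesis .
  qed
  have c0: "0 \<le> c" unfolding c_def by (rule L2_inner_self_nonneg)
  have "b\<^sup>2 \<le> a * c"
  proof (cases "c = 0")
    case True
    have "b = 0"
    proof (rule ccontr)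
      assume "b \<noteq> 0"
      \<comment> \<open>With \<open>c = 0\<close> the quadratic is linear in \<open>t\<close>; this
        choice of \<open>t\<close> gives it the value -1.\<close>
      then show False
        using q[of "(a + 1) / (2 * b)"] True by (simp add: field_simps)
    qed
    then show ?thesis using True by simp
  next
    case False
    have "0 \<le> c * (a - 2 * (b / c) * b + (b / c)\<^sup>2 * c)"
      by (rule mult_nonneg_nonneg[OF c0 q])
    also have "\<dots> = a * c - b\<^sup>2"
      using False by (simp add: field_simps power2_eq_square)
    finally show ?thesis by simp
  qed
  then have "sqrt (b\<^sup>2) \<le> sqrt (a * c)" by (rule real_sqrt_le_mono)
  then show ?thesis
    by (simp add: a_def b_def c_def L2_norm_def real_sqrt_mult)
qed

text \<open>By Cauchy-Schwarz, convergence in norm passes to pairings with a fixed element. The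
  filter is left general because both sequences and nets of finite subsets occur below.\<close>

lemma tendsto_L2_inner_left:
  assumes lim: "((\<lambda>n. L2_norm \<Omega> (\<lambda>x. f x - g n x)) \<longlongrightarrow> 0) F"
    and g: "\<forall>\<^sub>F n in F. g n \<in> L2 \<Omega>" and f: "f \<in> L2 \<Omega>" and h: "h \<in> L2 \<Omega>"
  shows "((\<lambda>n. L2_inner \<Omega> (g n) h) \<longlongrightarrow> L2_inner \<Omega> f h) F"
proof (rule Lim_transform2[OF tendsto_const])
  show "((\<lambda>n. L2_inner \<Omega> f h - L2_inner \<Omega> (g n) h) \<longlongrightarrow> 0) F"
  proof (rule Lim_null_comparison)
    show "\<forall>\<^sub>F n in F. norm (L2_inner \<Omega> f h - L2_inner \<Omega> (g n) h)
        \<le> L2_norm \<Omega> (\<lambda>x. f x - g n x) * L2_norm \<Omega> h"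
      using g
    proof eventually_elim
      case (elim n)
      then show ?case
        using L2_inner_Cauchy_Schwarz[OF L2_diff[OF f elim] h] f h
        by (simp add: L2_inner_diff_left)
    qed
    show "((\<lambda>n. L2_norm \<Omega> (\<lambda>x. f x - g n x) * L2_norm \<Omega> h) \<longlongrightarrow> 0) F"
      using tendsto_mult[OF lim tendsto_const, of "L2_norm \<Omega> h"] by simp
  qed
qed

lemma L2_inner_cong_AE:
  assumes "f \<in> L2 \<Omega>" "g \<in> L2 \<Omega>" "h \<in> L2 \<Omega>" and "AE x in lebesgue_on \<Omega>. f x = g x"
  shows "L2_inner \<Omega> f h = L2_inner \<Omega> g h"
  unfolding L2_inner_def using assms
  by (intro integral_cong_AE) (auto simp: L2_def)

section \<open>Orthonormal expansions and completeness of L2\<close>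

definition L2_orthonormal :: "'a::euclidean_space set \<Rightarrow> ('a \<Rightarrow> real) set \<Rightarrow> bool" where
  "L2_orthonormal \<Omega> B \<longleftrightarrow> B \<subseteq> L2 \<Omega> \<and>
    (\<forall>\<phi>\<in>B. \<forall>\<psi>\<in>B. L2_inner \<Omega> \<phi> \<psi> = (if \<phi> = \<psi> then 1 else 0))"

lemma L2_expansion:
  assumes "L2_orthonormal \<Omega> B" "F \<subseteq> B"
  shows "(\<lambda>x. \<Sum>\<phi>\<in>F. c \<phi> * \<phi> x) \<in> L2 \<Omega>"
  using assms by (intro L2_sum L2_scale) (auto simp: L2_orthonormal_def)

lemma L2_inner_expansion:
  assumes "L2_orthonormal \<Omega> B" "finite F" "F \<subseteq> B" "\<psi> \<in> B"
  shows "L2_inner \<Omega> (\<lambda>x. \<Sum>\<phi>\<in>F. c \<phi> * \<phi> x) \<psi> = (if \<psi> \<in> F then c \<psi> else 0)"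
proof -
  have "L2_inner \<Omega> (\<lambda>x. \<Sum>\<phi>\<in>F. c \<phi> * \<phi> x) \<psi> = (\<Sum>\<phi>\<in>F. c \<phi> * L2_inner \<Omega> \<phi> \<psi>)"
    using assms by (subst L2_inner_sum_left)
      (auto simp: L2_orthonormal_def L2_inner_scale_left intro!: L2_scale)
  also have "\<dots> = (\<Sum>\<phi>\<in>F. if \<phi> = \<psi> then c \<phi> else 0)"
    using assms by (intro sum.cong) (auto simp: L2_orthonormal_def)
  finally show ?thesis using assms(2) by simp
qed

text \<open>Pythagoras: the partial sum \<open>S\<close> satisfies \<open>(S, S) = (S, w)\<close>,
  so the residual is orthogonal to it.\<close>

lemma L2_norm_diff_expansion:
  assumes B: "L2_orthonormal \<Omega> B" and F: "finite F" "F \<subseteq> B" and w: "w \<in> L2 \<Omega>"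
    and c: "\<And>\<phi>. \<phi> \<in> F \<Longrightarrow> L2_inner \<Omega> w \<phi> = c \<phi>"
  shows "(L2_norm \<Omega> (\<lambda>x. w x - (\<Sum>\<phi>\<in>F. c \<phi> * \<phi> x)))\<^sup>2 = (L2_norm \<Omega> w)\<^sup>2 - (\<Sum>\<phi>\<in>F. (c \<phi>)\<^sup>2)"
proof -
  define S where "S x = (\<Sum>\<phi>\<in>F. c \<phi> * \<phi> x)" for x
  have S: "S \<in> L2 \<Omega>" unfolding S_def by (rule L2_expansion[OF B F(2)])
  have inS: "L2_inner \<Omega> S h = (\<Sum>\<phi>\<in>F. c \<phi> * L2_inner \<Omega> h \<phi>)" if "h \<in> L2 \<Omega>" for h
    unfolding S_def using B F that
    by (subst L2_inner_sum_left)
      (auto simp: L2_orthonormal_def L2_inner_scale_left L2_inner_commute[of \<Omega> h] intro!: L2_scale)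
  have "L2_inner \<Omega> S \<phi> = c \<phi>" if "\<phi> \<in> F" for \<phi>
    unfolding S_def using L2_inner_expansion[OF B F, of \<phi> c] that F(2) by auto
  then have "L2_inner \<Omega> S S = (\<Sum>\<phi>\<in>F. (c \<phi>)\<^sup>2)" "L2_inner \<Omega> S w = (\<Sum>\<phi>\<in>F. (c \<phi>)\<^sup>2)"
    using c by (simp_all add: inS S w power2_eq_square)
  then show ?thesis
    unfolding L2_norm_power2 S_def[symmetric]
    by (simp add: L2_inner_diff_left L2_inner_diff_right L2_diff S w L2_inner_commute[of \<Omega> w S])
qed

text \<open>Pairing the partial sums with \<phi> is constant as soon as the finite set contains
  \<phi>, which identifies the coefficients. Pythagoras then turns the vanishing of the residual
  into Parseval's identity for this \<open>w\<close>.\<close>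

lemma L2_expansion_limit:
  assumes B: "L2_orthonormal \<Omega> B" and w: "w \<in> L2 \<Omega>"
    and lim: "((\<lambda>F. L2_norm \<Omega> (\<lambda>x. w x - (\<Sum>\<phi>\<in>F. c \<phi> * \<phi> x))) \<longlongrightarrow> 0) (finite_subsets_at_top B)"
  shows "\<And>\<phi>. \<phi> \<in> B \<Longrightarrow> L2_inner \<Omega> w \<phi> = c \<phi>"
    and "((\<lambda>\<phi>. (c \<phi>)\<^sup>2) has_sum (L2_norm \<Omega> w)\<^sup>2) B"
proof -
  show c: "L2_inner \<Omega> w \<phi> = c \<phi>" if "\<phi> \<in> B" for \<phi>
  proof (rule tendsto_unique[OF finite_subsets_at_top_neq_bot])
    show "((\<lambda>F. L2_inner \<Omega> (\<lambda>x. \<Sum>\<phi>\<in>F. c \<phi> * \<phi> x) \<phi>) \<longlongrightarrow> L2_inner \<Omega> w \<phi>)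
        (finite_subsets_at_top B)"
      using lim w B that
      by (intro tendsto_L2_inner_left eventually_finite_subsets_at_top_weakI L2_expansion[OF B])
        (auto simp: L2_orthonormal_def)
    show "((\<lambda>F. L2_inner \<Omega> (\<lambda>x. \<Sum>\<phi>\<in>F. c \<phi> * \<phi> x) \<phi>) \<longlongrightarrow> c \<phi>) (finite_subsets_at_top B)"
    proof (rule tendsto_eventually)
      show "\<forall>\<^sub>F F in finite_subsets_at_top B. L2_inner \<Omega> (\<lambda>x. \<Sum>\<phi>\<in>F. c \<phi> * \<phi> x) \<phi> = c \<phi>"
        unfolding eventually_finite_subsets_at_top
        using that L2_inner_expansion[OF B _ _ that, of _ c]
        by (intro exI[of _ "{\<phi>}"]) auto
    qed
  qed
  have "((\<lambda>F. (L2_norm \<Omega> w)\<^sup>2 - (L2_norm \<Omega> (\<lambda>x. w x - (\<Sum>\<phi>\<in>F. c \<phi> * \<phi> x)))\<^sup>2)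
      \<longlongrightarrow> (L2_norm \<Omega> w)\<^sup>2 - 0\<^sup>2) (finite_subsets_at_top B)"
    by (intro tendsto_intros lim)
  moreover have "\<forall>\<^sub>F F in finite_subsets_at_top B.
      (L2_norm \<Omega> w)\<^sup>2 - (L2_norm \<Omega> (\<lambda>x. w x - (\<Sum>\<phi>\<in>F. c \<phi> * \<phi> x)))\<^sup>2 = (\<Sum>\<phi>\<in>F. (c \<phi>)\<^sup>2)"
    using L2_norm_diff_expansion[OF B _ _ w, of _ c] c
    by (intro eventually_finite_subsets_at_top_weakI) (auto simp: subset_iff)
  ultimately show "((\<lambda>\<phi>. (c \<phi>)\<^sup>2) has_sum (L2_norm \<Omega> w)\<^sup>2) B"
    unfolding has_sum_def by (auto intro: Lim_transform_eventually)
qed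

text \<open>Summable coefficients are realised by a function; this is what later puts a function
  into the domain of a fractional power. A rapidly converging sequence of partial sums has a limit
  almost everywhere, Fatou's lemma makes it a limit in norm, and Pythagoras passes from the sequence
  to the net of all finite subsets.\<close>

theorem Riesz_Fischer:
  assumes B: "L2_orthonormal \<Omega> B" and c: "(\<lambda>\<phi>. (c \<phi>)\<^sup>2) summable_on B"
  obtains w where "w \<in> L2 \<Omega>"
    "((\<lambda>F. L2_norm \<Omega> (\<lambda>x. w x - (\<Sum>\<phi>\<in>F. c \<phi> * \<phi> x))) \<longlongrightarrow> 0) (finite_subsets_at_top B)"
proof -
  define T where "T = infsum (\<lambda>\<phi>. (c \<phi>)\<^sup>2) B"
  have T: "(sum (\<lambda>\<phi>. (c \<phi>)\<^sup>2) \<longlongrightarrow> T) (finite_subsets_at_top B)"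
    using has_sum_infsum[OF c] by (simp add: has_sum_def T_def)
  have le_T: "(\<Sum>\<phi>\<in>F. (c \<phi>)\<^sup>2) \<le> T" if "finite F" "F \<subseteq> B" for F
    unfolding T_def using that by (intro finite_sum_le_infsum c) auto
  have "\<exists>G. finite G \<and> G \<subseteq> B \<and> (\<forall>F. finite F \<and> G \<subseteq> F \<and> F \<subseteq> B \<longrightarrow> T - (\<Sum>\<phi>\<in>F. (c \<phi>)\<^sup>2) \<le> (1 / 4) ^ n)"
    for n
  proof -
    have "\<forall>\<^sub>F F in finite_subsets_at_top B. dist (\<Sum>\<phi>\<in>F. (c \<phi>)\<^sup>2) T < (1 / 4) ^ n"
      by (rule tendstoD[OF T]) simp
    then obtain G where "finite G" "G \<subseteq> B"
      and G: "\<forall>F. finite F \<and> G \<subseteq> F \<and> F \<subseteq> B \<longrightarrow> dist (\<Sum>\<phi>\<in>F. (c \<phi>)\<^sup>2) T < (1 / 4) ^ n"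
      unfolding eventually_finite_subsets_at_top by blast
    have "T - (\<Sum>\<phi>\<in>F. (c \<phi>)\<^sup>2) \<le> (1 / 4) ^ n" if "finite F" "G \<subseteq> F" "F \<subseteq> B" for F
      using G[rule_format, of F] that by (simp add: dist_real_def)
    with \<open>finite G\<close> \<open>G \<subseteq> B\<close> show ?thesis by (intro exI[of _ G] conjI allI impI) auto
  qed
  then obtain G where G: "\<And>n. finite (G n)" "\<And>n. G n \<subseteq> B"
    "\<And>n F. finite F \<Longrightarrow> G n \<subseteq> F \<Longrightarrow> F \<subseteq> B \<Longrightarrow> T - (\<Sum>\<phi>\<in>F. (c \<phi>)\<^sup>2) \<le> (1 / 4) ^ n"
    by metis
  \<comment> \<open>Unions make the finite sets increasing; they need not exhaust \<open>B\<close>,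
    but the coefficients outside \<open>H n\<close> carry at most
    \<open>(1 / 4) ^ n\<close>.\<close>
  define H where "H n = (\<Union>k\<le>n. G k)" for n :: nat
  have H: "finite (H n)" "H n \<subseteq> B" for n using G by (auto simp: H_def)
  have tail: "T - (\<Sum>\<phi>\<in>H n. (c \<phi>)\<^sup>2) \<le> (1 / 4) ^ n" for n
    by (rule G(3)[OF H(1) _ H(2)]) (auto simp: H_def)
  have H_mono: "H n \<subseteq> H m" if "n \<le> m" for n m using that by (force simp: H_def)
  define S where "S n x = (\<Sum>\<phi>\<in>H n. c \<phi> * \<phi> x)" for n x
  have S: "S n \<in> L2 \<Omega>" for n unfolding S_def by (rule L2_expansion[OF B H(2)])
  have inner_S: "L2_inner \<Omega> (S n) \<phi> = (if \<phi> \<in> H n then c \<phi> else 0)" if "\<phi> \<in> B" for n \<phi>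
    unfolding S_def by (rule L2_inner_expansion[OF B H that])
  have S_diff: "(L2_norm \<Omega> (\<lambda>x. S m x - S n x))\<^sup>2 \<le> (1 / 4) ^ n" if "n \<le> m" for n m
  proof -
    have *: "(L2_norm \<Omega> (\<lambda>x. S m x - S k x))\<^sup>2 = (L2_norm \<Omega> (S m))\<^sup>2 - (\<Sum>\<phi>\<in>H k. (c \<phi>)\<^sup>2)"
      if "k \<le> m" for k
      unfolding S_def[of k]
    proof (rule L2_norm_diff_expansion[OF B H S])
      fix \<phi> assume "\<phi> \<in> H k"
      then have "\<phi> \<in> H m" "\<phi> \<in> B" using H_mono[OF that] H(2)[of k] by auto
      then show "L2_inner \<Omega> (S m) \<phi> = c \<phi>" by (simp add: inner_S)
    qed
    have "(L2_norm \<Omega> (S m))\<^sup>2 = (\<Sum>\<phi>\<in>H m. (c \<phi>)\<^sup>2)"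
      using *[of m] by (simp add: L2_norm_def L2_inner_def sum_nonneg)
    then show ?thesis
      using *[OF that] tail[of n] le_T[OF H, of m] by simp
  qed
  let ?M = "lebesgue_on \<Omega>"
  have S_meas [measurable]: "S n \<in> borel_measurable ?M" for n using S by (simp add: L2_def)
  have S_nn: "(\<integral>\<^sup>+x. ennreal ((S m x - S n x)\<^sup>2) \<partial>?M) \<le> ennreal ((1 / 4) ^ n)" if "n \<le> m" for n m
  proof -
    have "(\<integral>\<^sup>+x. ennreal ((S m x - S n x)\<^sup>2) \<partial>?M) = ennreal ((L2_norm \<Omega> (\<lambda>x. S m x - S n x))\<^sup>2)"
      unfolding L2_norm_power2 L2_inner_def power2_eq_square[symmetric]
      using L2_diff[OF S S, of m n] by (intro nn_integral_eq_integral) (auto simp: L2_def)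
    then show ?thesis using S_diff[OF that] by (simp add: ennreal_leI)
  qed
  \<comment> \<open>The squared norm of the increment \<open>d n\<close> is at most
    \<open>(1 / 4) ^ n\<close>. The weight \<open>2 ^ n\<close> still leaves a summable bound, so
    the weighted series of squares is finite almost everywhere.\<close>
  define d where "d n x = S (Suc n) x - S n x" for n x
  have d_meas [measurable]: "d n \<in> borel_measurable ?M" for n unfolding d_def by measurable
  have "(\<integral>\<^sup>+x. (\<Sum>n. ennreal (2 ^ n * (d n x)\<^sup>2)) \<partial>?M) = (\<Sum>n. \<integral>\<^sup>+x. ennreal (2 ^ n * (d n x)\<^sup>2) \<partial>?M)"
    by (intro nn_integral_suminf) measurable
  also have "\<dots> \<le> (\<Sum>n. ennreal ((1 / 2) ^ n))"
  proof (rule suminf_le)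
    show "(\<integral>\<^sup>+x. ennreal (2 ^ n * (d n x)\<^sup>2) \<partial>?M) \<le> ennreal ((1 / 2) ^ n)" for n
    proof -
      have "(\<integral>\<^sup>+x. ennreal (2 ^ n * (d n x)\<^sup>2) \<partial>?M) = ennreal (2 ^ n) * (\<integral>\<^sup>+x. ennreal ((d n x)\<^sup>2) \<partial>?M)"
        by (subst nn_integral_cmult[symmetric]) (auto simp: ennreal_mult)
      also have "\<dots> \<le> ennreal (2 ^ n) * ennreal ((1 / 4) ^ n)"
        unfolding d_def by (intro mult_left_mono S_nn) auto
      also have "\<dots> = ennreal ((1 / 2) ^ n)"
        by (simp flip: ennreal_mult power_mult_distrib)
      finally show ?thesis .
    qed
  qed auto
  also have "\<dots> = ennreal (\<Sum>n. (1 / 2) ^ n)"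
    by (rule suminf_ennreal2) (auto simp: summable_geometric)
  also have "\<dots> < \<infinity>" by simp
  finally have "AE x in ?M. (\<Sum>n. ennreal (2 ^ n * (d n x)\<^sup>2)) \<noteq> \<infinity>"
    by (intro nn_integral_PInf_AE) auto
  then have conv: "AE x in ?M. (\<lambda>n. S n x) \<longlonglongrightarrow> lim (\<lambda>n. S n x)"
  proof eventually_elim
    case (elim x)
    have s: "summable (\<lambda>n. 2 ^ n * (d n x)\<^sup>2)"
      using elim by (intro summable_suminf_not_top) auto
    \<comment> \<open>Either the increment is at most \<open>(1 / 2) ^ n\<close>, or multiplying it
      by \<open>2 ^ n * \<bar>d n x\<bar> \<ge> 1\<close> only enlarges it. The weighted squares
      therefore control the series of increments itself.\<close>
    have bd: "norm (d n x) \<le> (1 / 2) ^ n + 2 ^ n * (d n x)\<^sup>2" for n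
    proof (cases "\<bar>d n x\<bar> \<le> (1 / 2) ^ n")
      case True
      then show ?thesis by (simp add: add_increasing2)
    next
      case False
      then have "1 \<le> 2 ^ n * \<bar>d n x\<bar>" by (simp add: field_simps)
      then have "1 * \<bar>d n x\<bar> \<le> (2 ^ n * \<bar>d n x\<bar>) * \<bar>d n x\<bar>" by (intro mult_right_mono) auto
      then show ?thesis by (simp add: power2_eq_square mult.assoc add_increasing)
    qed
    have "summable (\<lambda>n. d n x)"
      by (rule summable_comparison_test'[OF summable_add[OF summable_geometric s] bd]) simp
    then have "convergent (\<lambda>n. \<Sum>k<n. d k x)" by (simp add: summable_iff_convergent)
    moreover have "(\<Sum>k<n. d k x) = S n x - S 0 x" for n
      unfolding d_def by (rule sum_lessThan_telescope)
    ultimately have "convergent (\<lambda>n. S n x)"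
      using convergent_add[OF _ convergent_const[of "S 0 x"], of "\<lambda>n. S n x - S 0 x"] by simp
    then show ?case by (simp add: convergent_LIMSEQ_iff)
  qed
  define w where "w x = lim (\<lambda>n. S n x)" for x
  have w_meas [measurable]: "w \<in> borel_measurable ?M" unfolding w_def by measurable
  \<comment> \<open>Fatou's lemma in \<open>m\<close>: almost everywhere the squared distance of
    \<open>w\<close> to \<open>S n\<close> is the lower limit of those of \<open>S m\<close> to
    \<open>S n\<close>.\<close>
  have w_nn: "(\<integral>\<^sup>+x. ennreal ((w x - S n x)\<^sup>2) \<partial>?M) \<le> ennreal ((1 / 4) ^ n)" for n
  proof -
    have "(\<integral>\<^sup>+x. ennreal ((w x - S n x)\<^sup>2) \<partial>?M)
        = (\<integral>\<^sup>+x. liminf (\<lambda>m. ennreal ((S m x - S n x)\<^sup>2)) \<partial>?M)"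
    proof (rule nn_integral_cong_AE)
      show "AE x in ?M. ennreal ((w x - S n x)\<^sup>2) = liminf (\<lambda>m. ennreal ((S m x - S n x)\<^sup>2))"
        using conv
      proof eventually_elim
        case (elim x)
        then have "(\<lambda>m. ennreal ((S m x - S n x)\<^sup>2)) \<longlonglongrightarrow> ennreal ((w x - S n x)\<^sup>2)"
          unfolding w_def by (intro tendsto_intros) auto
        then show ?case using lim_imp_Liminf[OF sequentially_bot] by metis
      qed
    qed
    also have "\<dots> \<le> liminf (\<lambda>m. \<integral>\<^sup>+x. ennreal ((S m x - S n x)\<^sup>2) \<partial>?M)"
      by (intro nn_integral_liminf) measurable
    also have "\<dots> \<le> ennreal ((1 / 4) ^ n)"
    proof (rule Liminf_le)
      show "\<forall>\<^sub>F m in sequentially. (\<integral>\<^sup>+x. ennreal ((S m x - S n x)\<^sup>2) \<partial>?M) \<le> ennreal ((1 / 4) ^ n)"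
        using eventually_ge_at_top[of n] by eventually_elim (rule S_nn)
    qed simp
    finally show ?thesis .
  qed
  have wS: "(\<lambda>x. w x - S n x) \<in> L2 \<Omega>" for n
    using w_nn[of n] unfolding L2_def
    by (auto intro!: integrableI_nonneg elim: le_less_trans)
  have w: "w \<in> L2 \<Omega>" using L2_add[OF wS S, of 0 0] by simp
  have w_norm: "(L2_norm \<Omega> (\<lambda>x. w x - S n x))\<^sup>2 \<le> (1 / 4) ^ n" for n
  proof -
    have "ennreal ((L2_norm \<Omega> (\<lambda>x. w x - S n x))\<^sup>2) = (\<integral>\<^sup>+x. ennreal ((w x - S n x)\<^sup>2) \<partial>?M)"
      unfolding L2_norm_power2 L2_inner_def power2_eq_square[symmetric]
      using wS[of n] by (intro nn_integral_eq_integral[symmetric]) (auto simp: L2_def)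
    from ord_eq_le_trans[OF this w_nn] show ?thesis by (subst (asm) ennreal_le_iff) auto
  qed
  have quarter: "(\<lambda>n. (1 / 4 :: real) ^ n) \<longlonglongrightarrow> 0" by (rule LIMSEQ_power_zero) simp
  have "(\<lambda>n. (L2_norm \<Omega> (\<lambda>x. w x - S n x))\<^sup>2) \<longlonglongrightarrow> 0"
    by (rule tendsto_sandwich[OF _ _ tendsto_const quarter]) (auto simp: w_norm)
  note w_lim2 = this
  from tendsto_real_sqrt[OF this] have w_lim: "(\<lambda>n. L2_norm \<Omega> (\<lambda>x. w x - S n x)) \<longlonglongrightarrow> 0"
    by (simp add: L2_norm_nonneg)
  have w_inner: "L2_inner \<Omega> w \<phi> = c \<phi>" if \<phi>: "\<phi> \<in> B" for \<phi>
  proof (rule LIMSEQ_unique)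
    show "(\<lambda>n. L2_inner \<Omega> (S n) \<phi>) \<longlonglongrightarrow> L2_inner \<Omega> w \<phi>"
      using w_lim S w \<phi> B by (intro tendsto_L2_inner_left) (auto simp: L2_orthonormal_def)
    \<comment> \<open>If \<phi> lies outside \<open>H n\<close>, then \<open>c \<phi>\<close>
      squared is part of the tail beyond \<open>H n\<close>. In particular a \<phi> that no
      \<open>H n\<close> contains has coefficient zero.\<close>
    have "(L2_inner \<Omega> (S n) \<phi> - c \<phi>)\<^sup>2 \<le> (1 / 4) ^ n" for n
    proof (cases "\<phi> \<in> H n")
      case False
      then show ?thesis
        using tail[of n] le_T[of "insert \<phi> (H n)"] H[of n] \<phi> by (simp add: inner_S)
    qed (simp add: inner_S \<phi>)
    then have "(\<lambda>n. (L2_inner \<Omega> (S n) \<phi> - c \<phi>)\<^sup>2) \<longlonglongrightarrow> 0"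
      by (intro tendsto_sandwich[OF _ _ tendsto_const quarter]) auto
    from tendsto_real_sqrt[OF this] have "(\<lambda>n. L2_inner \<Omega> (S n) \<phi> - c \<phi>) \<longlonglongrightarrow> 0"
      by (simp add: tendsto_rabs_zero_iff)
    then show "(\<lambda>n. L2_inner \<Omega> (S n) \<phi>) \<longlonglongrightarrow> c \<phi>" by (simp add: LIM_zero_iff)
  qed
  have w_exp: "(L2_norm \<Omega> (\<lambda>x. w x - (\<Sum>\<phi>\<in>F. c \<phi> * \<phi> x)))\<^sup>2 = (L2_norm \<Omega> w)\<^sup>2 - (\<Sum>\<phi>\<in>F. (c \<phi>)\<^sup>2)"
    if "finite F" "F \<subseteq> B" for F
    using w_inner that by (intro L2_norm_diff_expansion[OF B _ _ w]) (auto simp: subset_iff)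
  \<comment> \<open>Along \<open>H n\<close> the squared residual tends to 0 by construction and to
    the squared norm of \<open>w\<close> minus \<open>T\<close> by Pythagoras. Once these agree, the
    convergence of the sums to \<open>T\<close> gives the limit over all finite subsets.\<close>
  have "(L2_norm \<Omega> w)\<^sup>2 - T = 0"
  proof (rule LIMSEQ_unique[OF _ w_lim2])
    have "(\<lambda>n. T - (\<Sum>\<phi>\<in>H n. (c \<phi>)\<^sup>2)) \<longlonglongrightarrow> 0"
      by (rule tendsto_sandwich[OF _ _ tendsto_const quarter]) (auto simp: tail le_T H)
    from tendsto_add[OF tendsto_const[of "(L2_norm \<Omega> w)\<^sup>2 - T"] this]
    show "(\<lambda>n. (L2_norm \<Omega> (\<lambda>x. w x - S n x))\<^sup>2) \<longlonglongrightarrow> (L2_norm \<Omega> w)\<^sup>2 - T"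
      by (simp add: S_def w_exp H)
  qed
  then have "((\<lambda>F. (L2_norm \<Omega> w)\<^sup>2 - (\<Sum>\<phi>\<in>F. (c \<phi>)\<^sup>2)) \<longlongrightarrow> 0) (finite_subsets_at_top B)"
    using tendsto_diff[OF tendsto_const[of "(L2_norm \<Omega> w)\<^sup>2"] T] by simp
  moreover have "\<forall>\<^sub>F F in finite_subsets_at_top B.
      (L2_norm \<Omega> w)\<^sup>2 - (\<Sum>\<phi>\<in>F. (c \<phi>)\<^sup>2) = (L2_norm \<Omega> (\<lambda>x. w x - (\<Sum>\<phi>\<in>F. c \<phi> * \<phi> x)))\<^sup>2"
    by (intro eventually_finite_subsets_at_top_weakI) (simp add: w_exp)
  ultimately have "((\<lambda>F. (L2_norm \<Omega> (\<lambda>x. w x - (\<Sum>\<phi>\<in>F. c \<phi> * \<phi> x)))\<^sup>2) \<longlongrightarrow> 0)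
      (finite_subsets_at_top B)"
    by (rule Lim_transform_eventually)
  from tendsto_real_sqrt[OF this] show thesis
    by (intro that[OF w]) (simp add: L2_norm_nonneg)
qed

section \<open>Weak gradients\<close>

lemma test_functions_L2:
  assumes "bounded_domain \<Omega>" and \<psi>: "\<psi> \<in> test_functions \<Omega>"
  shows "\<psi> \<in> L2 \<Omega>"
proof -
  have "cont_diff 0 \<psi>" using \<psi> unfolding test_functions_def by blast
  then have cont: "continuous_on UNIV \<psi>" by simp
  define K where "K = closure {x. \<psi> x \<noteq> 0}"
  have "compact K" using \<psi> by (simp add: test_functions_def K_def)
  then have "bounded (\<psi> ` K)"
    by (intro compact_imp_bounded compact_continuous_image continuous_on_subset[OF cont]) auto
  then obtain M where M: "\<forall>x\<in>K. \<bar>\<psi> x\<bar> \<le> M" by (auto simp: bounded_iff)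
  have bd: "\<bar>\<psi> x\<bar> \<le> max M 0" for x
    using M closure_subset[of "{x. \<psi> x \<noteq> 0}"] by (cases "\<psi> x = 0") (auto simp: K_def le_max_iff_disj)
  have meas: "\<psi> \<in> borel_measurable (lebesgue_on \<Omega>)"
    using borel_measurable_continuous_onI[OF cont]
    by (intro measurable_restrict_space1 measurable_completion) simp
  have "\<Omega> \<in> lmeasurable"
    using assms(1) by (intro lmeasurable_open) (auto simp: bounded_domain_def)
  then interpret finite_measure "lebesgue_on \<Omega>" by (rule finite_measure_lebesgue_on)
  have "(\<psi> x)\<^sup>2 \<le> (max M 0)\<^sup>2" for x
    using power_mono[OF bd[of x], of 2] by simp
  then have "integrable (lebesgue_on \<Omega>) (\<lambda>x. (\<psi> x)\<^sup>2)"
    using meas by (intro integrable_const_bound[where B = "(max M 0)\<^sup>2"]) auto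
  with meas show ?thesis by (simp add: L2_def)
qed

text \<open>Off its closed support \<psi> vanishes on a neighbourhood, so differentiation does not
  enlarge the support. Derivatives can thus serve as test functions themselves.\<close>

lemma partial_deriv_test_functions:
  assumes \<psi>: "\<psi> \<in> test_functions \<Omega>" and b: "b \<in> Basis"
  shows "partial_deriv b \<psi> \<in> test_functions \<Omega>"
proof -
  define K where "K = closure {x. \<psi> x \<noteq> 0}"
  have K: "compact K" "K \<subseteq> \<Omega>" using \<psi> by (auto simp: test_functions_def K_def)
  have "cont_diff k (partial_deriv b \<psi>)" for k
  proof -
    have "cont_diff (Suc k) \<psi>" using \<psi> unfolding test_functions_def by blast
    then show ?thesis using b by simp
  qed
  moreover have "partial_deriv b \<psi> x = 0" if "x \<notin> K" for x
  proof -
    have "open (- K)" by (simp add: K_def open_Compl)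
    moreover have "0 = \<psi> y" if "y \<in> - K" for y
      using that closure_subset[of "{x. \<psi> x \<noteq> 0}"] by (auto simp: K_def)
    ultimately have "(\<psi> has_derivative (\<lambda>h. 0)) (at x)"
      using that by (intro has_derivative_transform_within_open[OF has_derivative_const]) auto
    then have "frechet_derivative \<psi> (at x) = (\<lambda>h. 0)"
      by (rule frechet_derivative_at[symmetric])
    then show ?thesis by (simp add: partial_deriv_def)
  qed
  then have sub: "closure {x. partial_deriv b \<psi> x \<noteq> 0} \<subseteq> K"
    by (intro closure_minimal) (auto simp: K_def)
  then have "compact (closure {x. partial_deriv b \<psi> x \<noteq> 0})"
    using compact_Int_closed[OF K(1) closed_closure] by (metis inf.absorb2)
  ultimately show ?thesis
    unfolding test_functions_def using K(2) sub by auto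
qed

text \<open>The witness hidden in \<open>H10\<close>: a weak gradient that is at the same time the
  L2 limit of gradients of test functions converging to \<open>v\<close>.\<close>

definition H10_gradient ::
  "'a::euclidean_space set \<Rightarrow> ('a \<Rightarrow> real) \<Rightarrow> ('a \<Rightarrow> 'a \<Rightarrow> real) \<Rightarrow> bool" where
  "H10_gradient \<Omega> v g \<longleftrightarrow> weak_gradient \<Omega> v g \<and>
    (\<exists>\<psi>. (\<forall>n::nat. \<psi> n \<in> test_functions \<Omega>) \<and>
         (\<lambda>n. L2_norm \<Omega> (\<lambda>x. v x - \<psi> n x)) \<longlonglongrightarrow> 0 \<and>
         (\<forall>b\<in>Basis. (\<lambda>n. L2_norm \<Omega> (\<lambda>x. g b x - partial_deriv b (\<psi> n) x)) \<longlonglongrightarrow> 0))"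

lemma H10_iff: "v \<in> H10 \<Omega> \<longleftrightarrow> v \<in> L2 \<Omega> \<and> (\<exists>g. H10_gradient \<Omega> v g)"
  by (auto simp: H10_def H10_gradient_def)

text \<open>One sequence of test functions serves for all \<open>f\<close> and all directions; only
  the limits of the pairings are kept, since every later use tests against a fixed
  \<open>f\<close>.\<close>

lemma H10_gradient_limits:
  assumes \<Omega>: "bounded_domain \<Omega>" and w: "w \<in> L2 \<Omega>" "H10_gradient \<Omega> w k"
  obtains \<psi> :: "nat \<Rightarrow> 'a::euclidean_space \<Rightarrow> real" where "\<And>n. \<psi> n \<in> test_functions \<Omega>"
    "\<And>f. f \<in> L2 \<Omega> \<Longrightarrow> (\<lambda>n. L2_inner \<Omega> (\<psi> n) f) \<longlonglongrightarrow> L2_inner \<Omega> w f"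
    "\<And>f b. f \<in> L2 \<Omega> \<Longrightarrow> b \<in> Basis \<Longrightarrow>
      (\<lambda>n. L2_inner \<Omega> (partial_deriv b (\<psi> n)) f) \<longlonglongrightarrow> L2_inner \<Omega> (k b) f"
proof -
  from w(2) obtain \<psi> where \<psi>: "\<And>n::nat. \<psi> n \<in> test_functions \<Omega>"
    and lim: "(\<lambda>n. L2_norm \<Omega> (\<lambda>x. w x - \<psi> n x)) \<longlonglongrightarrow> 0"
      "\<And>b. b \<in> Basis \<Longrightarrow> (\<lambda>n. L2_norm \<Omega> (\<lambda>x. k b x - partial_deriv b (\<psi> n) x)) \<longlonglongrightarrow> 0"
    unfolding H10_gradient_def by blast
  have k: "k b \<in> L2 \<Omega>" if "b \<in> Basis" for b
    using w(2) that by (auto simp: H10_gradient_def weak_gradient_def)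
  show thesis
  proof (rule that[OF \<psi>])
    fix f assume f: "f \<in> L2 \<Omega>"
    show "(\<lambda>n. L2_inner \<Omega> (\<psi> n) f) \<longlonglongrightarrow> L2_inner \<Omega> w f"
      by (intro tendsto_L2_inner_left[OF lim(1) _ w(1) f] always_eventually allI
          test_functions_L2[OF \<Omega> \<psi>])
    fix b :: 'a assume b: "b \<in> Basis"
    show "(\<lambda>n. L2_inner \<Omega> (partial_deriv b (\<psi> n)) f) \<longlonglongrightarrow> L2_inner \<Omega> (k b) f"
      by (intro tendsto_L2_inner_left[OF lim(2)[OF b] _ k[OF b] f] always_eventually allI
          test_functions_L2[OF \<Omega>] partial_deriv_test_functions \<psi> b)
  qed
qed

text \<open>Two weak gradients of the same function need not be compared directly: gradients of functions
  in \<open>H10\<close> are limits of test functions, which cannot tell them apart.\<close>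

lemma H10_gradient_weak_gradient_unique:
  assumes \<Omega>: "bounded_domain \<Omega>" and w: "w \<in> L2 \<Omega>" "H10_gradient \<Omega> w k"
    and g: "weak_gradient \<Omega> v g" and g': "weak_gradient \<Omega> v g'" and b: "b \<in> Basis"
  shows "L2_inner \<Omega> (k b) (g b) = L2_inner \<Omega> (k b) (g' b)"
proof -
  obtain \<psi> :: "nat \<Rightarrow> 'a \<Rightarrow> real" where \<psi>: "\<And>n. \<psi> n \<in> test_functions \<Omega>"
    and lim: "\<And>f b. f \<in> L2 \<Omega> \<Longrightarrow> b \<in> Basis \<Longrightarrow>
      (\<lambda>n. L2_inner \<Omega> (partial_deriv b (\<psi> n)) f) \<longlonglongrightarrow> L2_inner \<Omega> (k b) f"
    by (rule H10_gradient_limits[OF \<Omega> w]) blast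
  \<comment> \<open>\<open>partial_deriv b (\<psi> n)\<close> is tested once more against the weak
    derivative of \<open>v\<close>, which leaves an expression in \<open>v\<close> alone.\<close>
  have *: "L2_inner \<Omega> (partial_deriv b (\<psi> n)) (h b) =
      - L2_inner \<Omega> v (partial_deriv b (partial_deriv b (\<psi> n)))" if "weak_gradient \<Omega> v h" for n h
    using that b partial_deriv_test_functions[OF \<psi> b, of n]
    by (simp add: weak_gradient_def weak_partial_def L2_inner_commute[of \<Omega> _ "h b"])
  have "g b \<in> L2 \<Omega>" "g' b \<in> L2 \<Omega>" using g g' b by (auto simp: weak_gradient_def)
  from lim[OF this(1) b] lim[OF this(2) b] show ?thesis
    unfolding *[OF g] *[OF g'] by (rule LIMSEQ_unique)
qed

text \<open>Green's formula \<open>(grad w, grad v) = (w, -Laplacian v)\<close>: integration by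
  parts against the test functions approximating \<open>w\<close> leaves no boundary term. The
  gradient \<open>g\<close> is arbitrary and may differ from the one that carries the second
  derivatives, so it is exchanged first.\<close>

lemma H10_Green:
  assumes \<Omega>: "bounded_domain \<Omega>" and w: "w \<in> L2 \<Omega>" "H10_gradient \<Omega> w k"
    and f: "lapA \<Omega> v f" and g: "weak_gradient \<Omega> v g"
  shows "(\<Sum>b\<in>Basis. L2_inner \<Omega> (k b) (g b)) = L2_inner \<Omega> w f"
proof -
  obtain g0 h where h: "weak_grad_hess \<Omega> v g0 h"
    and f_eq: "AE x in lebesgue_on \<Omega>. f x = - (\<Sum>b\<in>Basis. h b b x)" and f_L2: "f \<in> L2 \<Omega>"
    using f by (auto simp: lapA_def)
  have hbb: "h b b \<in> L2 \<Omega>" if "b \<in> Basis" for b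
    using h that by (auto simp: weak_grad_hess_def weak_gradient_def)
  obtain \<psi> :: "nat \<Rightarrow> 'a \<Rightarrow> real" where \<psi>: "\<And>n. \<psi> n \<in> test_functions \<Omega>"
    and lim: "\<And>f. f \<in> L2 \<Omega> \<Longrightarrow> (\<lambda>n. L2_inner \<Omega> (\<psi> n) f) \<longlonglongrightarrow> L2_inner \<Omega> w f"
      "\<And>f b. f \<in> L2 \<Omega> \<Longrightarrow> b \<in> Basis \<Longrightarrow>
      (\<lambda>n. L2_inner \<Omega> (partial_deriv b (\<psi> n)) f) \<longlonglongrightarrow> L2_inner \<Omega> (k b) f"
    by (rule H10_gradient_limits[OF \<Omega> w]) blast
  have "L2_inner \<Omega> (k b) (g b) = - L2_inner \<Omega> w (h b b)" if b: "b \<in> Basis" for b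
  proof -
    have "L2_inner \<Omega> (k b) (g b) = L2_inner \<Omega> (k b) (g0 b)"
      using h by (intro H10_gradient_weak_gradient_unique[OF \<Omega> w g _ b])
        (simp add: weak_grad_hess_def)
    also have "\<dots> = - L2_inner \<Omega> w (h b b)"
    proof (rule LIMSEQ_unique)
      show "(\<lambda>n. L2_inner \<Omega> (partial_deriv b (\<psi> n)) (g0 b)) \<longlonglongrightarrow> L2_inner \<Omega> (k b) (g0 b)"
        using h b by (intro lim(2)) (auto simp: weak_grad_hess_def weak_gradient_def)
      have "L2_inner \<Omega> (partial_deriv b (\<psi> n)) (g0 b) = - L2_inner \<Omega> (\<psi> n) (h b b)" for n
        using h b \<psi>[of n]
        by (simp add: weak_grad_hess_def weak_gradient_def weak_partial_def
            L2_inner_commute[of \<Omega> _ "g0 b"] L2_inner_commute[of \<Omega> _ "h b b"])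
      then show "(\<lambda>n. L2_inner \<Omega> (partial_deriv b (\<psi> n)) (g0 b)) \<longlonglongrightarrow> - L2_inner \<Omega> w (h b b)"
        using tendsto_minus[OF lim(1)[OF hbb[OF b]]] by simp
    qed
    finally show ?thesis .
  qed
  then have "(\<Sum>b\<in>Basis. L2_inner \<Omega> (k b) (g b)) = (\<Sum>b\<in>Basis. - L2_inner \<Omega> (h b b) w)"
    by (simp add: L2_inner_commute[of \<Omega> w])
  also have "\<dots> = L2_inner \<Omega> (\<lambda>x. - (\<Sum>b\<in>Basis. h b b x)) w"
    using L2_inner_sum_left[OF hbb w(1), of Basis "\<lambda>b. b"]
      L2_inner_scale_left[of \<Omega> "-1" "\<lambda>x. \<Sum>b\<in>Basis. h b b x" w]
    by (simp add: sum_negf)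
  also have "\<dots> = L2_inner \<Omega> f w"
    using f_eq L2_scale[OF L2_sum[OF hbb], of Basis "\<lambda>b. b" "-1"]
    by (intro L2_inner_cong_AE f_L2 w) auto
  finally show ?thesis by (simp add: L2_inner_commute)
qed

section \<open>The damped oscillator\<close>

text \<open>\<open>W\<close> is the energy of \<open>exp (\<delta> t) y\<close>. It decreases and is
  at most twice the rescaled oscillator energy, while that energy is at most \<open>2 + K\<close>
  times the unscaled bracket \<open>P\<close>; the product of the two factors is
  \<open>4 + 2 K\<close>.\<close>

lemma damped_oscillator_decay:
  fixes y z a a' :: "real \<Rightarrow> real" and \<nu> \<delta> K :: real
  assumes y: "\<And>t. t \<ge> 0 \<Longrightarrow> (y has_real_derivative z t) (at t within {0..})"
    and z: "\<And>t. t > 0 \<Longrightarrow> (z has_real_derivative - (a t * z t + \<nu> * y t)) (at t)"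
    and a: "\<And>t. t \<ge> 0 \<Longrightarrow> (a has_real_derivative a' t) (at t within {0..})"
    and a'_nonneg: "\<And>t. t \<ge> 0 \<Longrightarrow> 0 \<le> a' t"
    and \<delta>: "0 < \<delta>" "\<And>t. t \<ge> 0 \<Longrightarrow> 2 * \<delta> \<le> a t" "\<And>t. t \<ge> 0 \<Longrightarrow> a t * \<delta> \<le> \<nu>"
    and K: "\<And>t. t \<ge> 0 \<Longrightarrow> \<nu> \<le> K * (\<nu> - a t * \<delta> + \<delta>\<^sup>2)" and "t \<ge> 0"
  shows "(z t)\<^sup>2 + \<nu> * (y t)\<^sup>2 \<le> (4 + 2 * K) * exp (- 2 * \<delta> * t) * ((z 0)\<^sup>2 + \<nu> * (y 0)\<^sup>2)"
proof -
  define q where "q t = \<nu> - a t * \<delta> + \<delta>\<^sup>2" for t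
  define W where "W t = exp (2 * \<delta> * t) * ((z t + \<delta> * y t)\<^sup>2 + q t * (y t)\<^sup>2)" for t
  have at: "at t within {0..} = at t" if "t > 0" for t :: real
    using that by (intro at_within_interior) (simp add: interior_Ici)
  \<comment> \<open>For \<open>w = exp (\<delta> t) y\<close> the equation reads
    \<open>w'' + (a - 2 \<delta>) w' + q w = 0\<close>, so
    \<open>W' = -2 (a - 2 \<delta>) w'^2 + q' w^2\<close> with
    \<open>q' = -\<delta> a'\<close>.\<close>
  have W': "(W has_real_derivative
      - exp (2 * \<delta> * t) * (2 * (a t - 2 * \<delta>) * (z t + \<delta> * y t)\<^sup>2 + a' t * \<delta> * (y t)\<^sup>2)) (at t)"
    if "t > 0" for t
  proof -
    have dy: "(y has_real_derivative z t) (at t)" and da: "(a has_real_derivative a' t) (at t)"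
      using y[of t] a[of t] that by (simp_all add: at)
    show ?thesis
      unfolding W_def q_def
      by (rule derivative_eq_intros dy da z[OF that] refl)+
        (simp add: power2_eq_square algebra_simps)
  qed
  have W_mono: "W t \<le> W s" if "0 < s" "s \<le> t" for s t
  proof (rule DERIV_nonpos_imp_nonincreasing[OF that(2)])
    fix x assume "s \<le> x" "x \<le> t"
    with that have x: "x > 0" by simp
    have "0 \<le> exp (2 * \<delta> * x) * (2 * (a x - 2 * \<delta>) * (z x + \<delta> * y x)\<^sup>2 + a' x * \<delta> * (y x)\<^sup>2)"
      using \<delta>(1) \<delta>(2)[of x] a'_nonneg[of x] x by (intro mult_nonneg_nonneg add_nonneg_nonneg) auto
    then show "\<exists>d. (W has_real_derivative d) (at x) \<and> d \<le> 0"
      using W'[OF x] by (intro exI conjI) auto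
  qed
  \<comment> \<open>The chain \<open>2 \<delta>^2 \<le> a \<delta> \<le> \<nu>\<close> bounds the
    cross terms and also gives \<open>q \<le> \<nu>\<close>.\<close>
  have W_le: "W t \<le> 2 * exp (2 * \<delta> * t) * ((z t)\<^sup>2 + \<nu> * (y t)\<^sup>2)" if "t \<ge> 0" for t
  proof -
    have "2 * \<delta> * \<delta> \<le> a t * \<delta>"
      using \<delta>(1,2) that by (intro mult_right_mono) auto
    then have d2: "2 * \<delta>\<^sup>2 \<le> a t * \<delta>" by (simp add: power2_eq_square)
    have "(z t + \<delta> * y t)\<^sup>2 \<le> 2 * (z t)\<^sup>2 + (2 * \<delta>\<^sup>2) * (y t)\<^sup>2"
      using zero_le_power2[of "z t - \<delta> * y t"] by (simp add: power2_eq_square algebra_simps)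
    also have "\<dots> \<le> 2 * (z t)\<^sup>2 + \<nu> * (y t)\<^sup>2"
      using d2 \<delta>(3)[OF that] by (intro add_left_mono mult_right_mono) auto
    finally have 1: "(z t + \<delta> * y t)\<^sup>2 \<le> 2 * (z t)\<^sup>2 + \<nu> * (y t)\<^sup>2" .
    have "q t \<le> \<nu>" using d2 zero_le_power2[of \<delta>] unfolding q_def by linarith
    then have "q t * (y t)\<^sup>2 \<le> \<nu> * (y t)\<^sup>2" by (intro mult_right_mono) auto
    with 1 have "(z t + \<delta> * y t)\<^sup>2 + q t * (y t)\<^sup>2 \<le> 2 * ((z t)\<^sup>2 + \<nu> * (y t)\<^sup>2)" by simp
    then show ?thesis unfolding W_def by simp
  qed
  text \<open>Continuity of \<open>z\<close> at 0 is not assumed; mean value points supply times at which \<open>z\<close>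
    tends to \<open>z 0\<close>.\<close>
  have "\<exists>\<xi>. 0 < \<xi> \<and> \<xi> < inverse (real (Suc n)) \<and>
      (y (inverse (real (Suc n))) - y 0) / (inverse (real (Suc n)) - 0) = z \<xi>" for n
  proof -
    define h where "h = inverse (real (Suc n))"
    have h: "0 < h" by (simp add: h_def)
    obtain \<xi> where "\<xi> \<in> {0<..<h}" "y h - y 0 = z \<xi> * (h - 0)"
    proof -
      have "\<exists>x\<in>{0<..<h}. y h - y 0 = (*) (z x) (h - 0)"
      proof (rule mvt_simple[OF h])
        fix x assume "0 \<le> x" "x \<le> h"
        then show "(y has_derivative (*) (z x)) (at x within {0..h})"
          using y[of x] unfolding has_field_derivative_def
          by (rule_tac has_derivative_subset) auto
      qed
      then show thesis using that by blast
    qed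
    then show ?thesis using h unfolding h_def[symmetric] by (intro exI[of _ \<xi>]) auto
  qed
  then obtain \<xi> where \<xi>: "\<And>n. 0 < \<xi> n" "\<And>n. \<xi> n < inverse (real (Suc n))"
    and z\<xi>: "\<And>n. (y (inverse (real (Suc n))) - y 0) / (inverse (real (Suc n)) - 0) = z (\<xi> n)"
    by metis
  have inv: "(\<lambda>n. inverse (real (Suc n))) \<longlonglongrightarrow> 0" by (rule LIMSEQ_inverse_real_of_nat)
  have \<xi>0: "\<xi> \<longlonglongrightarrow> 0"
    by (rule tendsto_sandwich[OF _ _ tendsto_const inv]) (use \<xi> in \<open>auto intro!: always_eventually less_imp_le simp del: of_nat_Suc\<close>)
  have "((\<lambda>s. (y s - y 0) / (s - 0)) \<longlongrightarrow> z 0) (at 0 within {0..})"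
    using y[of 0] by (simp add: has_field_derivative_iff)
  moreover have "filterlim (\<lambda>n. inverse (real (Suc n))) (at 0 within {0..}) sequentially"
    using inv by (simp add: filterlim_at del: of_nat_Suc)
  ultimately have "(\<lambda>n. (y (inverse (real (Suc n))) - y 0) / (inverse (real (Suc n)) - 0)) \<longlonglongrightarrow> z 0"
    by (rule filterlim_compose)
  then have z0: "(\<lambda>n. z (\<xi> n)) \<longlonglongrightarrow> z 0" unfolding z\<xi> .
  have "continuous_on {0..} y"
    using y by (auto simp: continuous_on_eq_continuous_within intro: DERIV_continuous)
  then have y0: "(\<lambda>n. y (\<xi> n)) \<longlonglongrightarrow> y 0"
    using \<xi>(1) by (intro continuous_on_tendsto_compose[OF _ \<xi>0]) (auto intro!: always_eventually less_imp_le)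
  define E0 where "E0 = (z 0)\<^sup>2 + \<nu> * (y 0)\<^sup>2"
  \<comment> \<open>Monotonicity is available only between positive times, so \<open>W t\<close> is
    compared with \<open>W\<close> at the points \<open>\<xi> n\<close>, which then tend to
    0.\<close>
  have Wt: "W t \<le> 2 * E0"
  proof (cases "t = 0")
    case True
    then show ?thesis using W_le[of 0] by (simp add: E0_def)
  next
    case False
    with \<open>t \<ge> 0\<close> have t: "t > 0" by simp
    have "(\<lambda>n. 2 * exp (2 * \<delta> * \<xi> n) * ((z (\<xi> n))\<^sup>2 + \<nu> * (y (\<xi> n))\<^sup>2)) \<longlonglongrightarrow>
        2 * exp (2 * \<delta> * 0) * ((z 0)\<^sup>2 + \<nu> * (y 0)\<^sup>2)"
      by (intro tendsto_intros \<xi>0 z0 y0)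
    moreover have "\<forall>\<^sub>F n in sequentially. \<xi> n < t"
      using order_tendstoD(2)[OF \<xi>0 t] .
    then have "\<forall>\<^sub>F n in sequentially. W t \<le> 2 * exp (2 * \<delta> * \<xi> n) * ((z (\<xi> n))\<^sup>2 + \<nu> * (y (\<xi> n))\<^sup>2)"
    proof eventually_elim
      case (elim n)
      then show ?case
        using W_mono[OF \<xi>(1), of n t] W_le[of "\<xi> n"] \<xi>(1)[of n] by linarith
    qed
    ultimately have "W t \<le> 2 * exp (2 * \<delta> * 0) * ((z 0)\<^sup>2 + \<nu> * (y 0)\<^sup>2)"
      by (intro tendsto_lowerbound) auto
    then show ?thesis by (simp add: E0_def)
  qed
  have e: "exp (- 2 * \<delta> * t) * exp (2 * \<delta> * t) = 1"
    by (simp flip: exp_add)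
  define P where "P = (z t + \<delta> * y t)\<^sup>2 + q t * (y t)\<^sup>2"
  have "P = exp (- 2 * \<delta> * t) * W t"
    unfolding W_def P_def using e by (simp add: mult.assoc[symmetric])
  also have "\<dots> \<le> exp (- 2 * \<delta> * t) * (2 * E0)"
    by (intro mult_left_mono Wt) simp
  finally have P: "P \<le> 2 * exp (- 2 * \<delta> * t) * E0" by (simp add: mult_ac)
  have q: "\<delta>\<^sup>2 \<le> q t" using \<delta>(3)[OF \<open>t \<ge> 0\<close>] by (simp add: q_def)
  \<comment> \<open>The part of \<open>z\<close> lost in \<open>z + \<delta> y\<close> costs
    \<open>\<delta>^2 y^2\<close>, which the potential term absorbs because
    \<open>\<delta>^2 \<le> q\<close>.\<close>
  have "(z t)\<^sup>2 \<le> 2 * (z t + \<delta> * y t)\<^sup>2 + 2 * (\<delta>\<^sup>2 * (y t)\<^sup>2)"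
    using zero_le_power2[of "z t + 2 * \<delta> * y t"] by (simp add: power2_eq_square algebra_simps)
  also have "\<dots> \<le> 2 * P"
    using mult_right_mono[OF q, of "(y t)\<^sup>2"] by (simp add: P_def)
  finally have zt: "(z t)\<^sup>2 \<le> 2 * P" .
  have "0 < \<delta>\<^sup>2" using \<delta>(1) by simp
  then have q0: "0 < q t" using q by linarith
  have "0 \<le> a t * \<delta>" using \<delta>(1) \<delta>(2)[OF \<open>t \<ge> 0\<close>] by (intro mult_nonneg_nonneg) auto
  then have "0 \<le> \<nu>" using \<delta>(3)[OF \<open>t \<ge> 0\<close>] by linarith
  then have "0 \<le> K * q t" using K[OF \<open>t \<ge> 0\<close>] by (simp add: q_def)
  then have K0: "0 \<le> K" using q0 by (simp add: zero_le_mult_iff)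
  have "\<nu> * (y t)\<^sup>2 \<le> K * (q t * (y t)\<^sup>2)"
    using mult_right_mono[OF K[OF \<open>t \<ge> 0\<close>], of "(y t)\<^sup>2"] by (simp add: q_def mult.assoc)
  also have "\<dots> \<le> K * P" using K0 by (intro mult_left_mono) (auto simp: P_def)
  finally have "(z t)\<^sup>2 + \<nu> * (y t)\<^sup>2 \<le> (2 + K) * P" using zt by (simp add: algebra_simps)
  also have "\<dots> \<le> (2 + K) * (2 * exp (- 2 * \<delta> * t) * E0)"
    using K0 P by (intro mult_left_mono) auto
  finally show "(z t)\<^sup>2 + \<nu> * (y t)\<^sup>2
      \<le> (4 + 2 * K) * exp (- 2 * \<delta> * t) * ((z 0)\<^sup>2 + \<nu> * (y 0)\<^sup>2)"
    unfolding E0_def[symmetric] by (simp add: algebra_simps)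
qed

text \<open>\<open>\<nu> - c \<delta>\<close> can approach 0 only if \<delta> is near its upper
  bound and \<nu> is near \<mu>. There \<delta> is bounded below, so \<open>\<delta>^2\<close>
  replaces it, and the constant depends neither on \<nu> nor on \<delta>.\<close>

lemma stiffness_lower_bound:
  fixes \<nu> \<mu> a b c \<delta> :: real
  assumes "0 < \<mu>" "\<mu> \<le> \<nu>" "0 < a" "0 \<le> b" and c: "c \<le> a + b * \<nu>"
    and \<delta>: "0 < \<delta>" "\<delta> \<le> \<mu> / (a + b * \<mu>)"
  shows "c * \<delta> \<le> \<nu>"
    and "\<nu> \<le> (2 + 2 * (a + b * \<mu>) / a + 8 * (a + b * \<mu>)\<^sup>2 / \<mu>) * (\<nu> - c * \<delta> + \<delta>\<^sup>2)"
proof -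
  define D where "D = a + b * \<mu>"
  have D: "0 < D" "a \<le> D" using assms by (auto simp: D_def add_pos_nonneg)
  \<comment> \<open>\<theta> is the fraction of its largest admissible value that \<delta>
    attains.\<close>
  define \<theta> where "\<theta> = \<delta> * D / \<mu>"
  have \<theta>: "0 < \<theta>" "\<theta> \<le> 1"
    using \<delta> D(1) assms(1) unfolding D_def[symmetric] by (auto simp: \<theta>_def field_simps)
  have "\<delta> = \<theta> * \<mu> / D" using D assms(1) by (simp add: \<theta>_def)
  have "c * \<delta> \<le> (a + b * \<nu>) * \<delta>" using c \<delta>(1) by (intro mult_right_mono) auto
  \<comment> \<open>An identity, by \<open>\<delta> = \<theta> \<mu> / D\<close> and
    \<open>D = a + b \<mu>\<close>. It measures the slack gained from \<nu> exceeding \<mu>.\<close>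
  also have "\<dots> = \<theta> * (\<nu> - (a / D) * (\<nu> - \<mu>))"
    unfolding \<open>\<delta> = _\<close> using D(1) by (simp add: field_simps D_def)
  finally have r: "\<nu> - c * \<delta> \<ge> (1 - \<theta>) * \<nu> + \<theta> * ((a / D) * (\<nu> - \<mu>))"
    by (simp add: algebra_simps)
  define \<kappa> where "\<kappa> = a / D"
  have \<kappa>: "0 < \<kappa>" "\<kappa> \<le> 1" using D assms(3) by (auto simp: \<kappa>_def)
  have m: "0 \<le> \<theta> * (\<kappa> * (\<nu> - \<mu>))" "0 \<le> (1 - \<theta>) * \<nu>"
    using \<theta> \<kappa> assms by auto
  show "c * \<delta> \<le> \<nu>" using r m by (simp add: \<kappa>_def)
  define Q where "Q = \<nu> - c * \<delta> + \<delta>\<^sup>2"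
  have Q: "(1 - \<theta>) * \<nu> + \<theta> * (\<kappa> * (\<nu> - \<mu>)) + \<delta>\<^sup>2 \<le> Q" using r by (simp add: Q_def \<kappa>_def)
  have Q0: "0 \<le> Q" using Q m zero_le_power2[of \<delta>] by linarith
  have k: "2 * D / a = 2 / \<kappa>" by (simp add: \<kappa>_def)
  have n: "0 \<le> 2 / \<kappa> * Q" "0 \<le> 8 * D\<^sup>2 / \<mu> * Q" using \<kappa> Q0 assms(1) by auto
  \<comment> \<open>The three cases account for the three summands of the constant: \<delta> well
    below its bound gives \<open>2\<close>, \<nu> well above \<mu> gives
    \<open>2 / \<kappa>\<close>, and the degenerate corner gives \<open>8 D^2 / \<mu>\<close>, where
    \<open>\<delta> \<ge> \<mu> / (2 D)\<close>.\<close>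
  consider "\<theta> \<le> 1 / 2" | "1 / 2 \<le> \<theta>" "2 * \<mu> \<le> \<nu>" | "1 / 2 \<le> \<theta>" "\<nu> \<le> 2 * \<mu>" by linarith
  then have "\<nu> \<le> 2 * Q + 2 / \<kappa> * Q + 8 * D\<^sup>2 / \<mu> * Q"
  proof cases
    case 1
    then have "(1 / 2) * \<nu> \<le> (1 - \<theta>) * \<nu>" using assms by (intro mult_right_mono) auto
    then have "\<nu> \<le> 2 * Q" using Q m zero_le_power2[of \<delta>] by linarith
    then show ?thesis using n by linarith
  next
    case 2
    \<comment> \<open>Since \<open>\<kappa> \<le> 1\<close>, the convex combination in
      \<open>Q\<close> is at least \<open>\<kappa> (\<nu> - \<mu>)\<close>, whatever \<theta>
      is.\<close>
    have "\<kappa> * (\<nu> - \<mu>) \<le> 1 * \<nu>" using \<kappa> assms by (intro mult_mono) auto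
    then have "(1 - \<theta>) * (\<kappa> * (\<nu> - \<mu>)) \<le> (1 - \<theta>) * \<nu>"
      using \<theta> by (intro mult_left_mono) auto
    moreover have "(1 - \<theta>) * (\<kappa> * (\<nu> - \<mu>)) + \<theta> * (\<kappa> * (\<nu> - \<mu>)) = \<kappa> * (\<nu> - \<mu>)"
      by (simp add: algebra_simps)
    ultimately have "\<kappa> * (\<nu> - \<mu>) \<le> Q" using Q zero_le_power2[of \<delta>] by linarith
    moreover have "\<kappa> * (\<nu> / 2) \<le> \<kappa> * (\<nu> - \<mu>)" using \<kappa>(1) 2 by (intro mult_left_mono) auto
    ultimately have "\<kappa> * (\<nu> / 2) \<le> Q" by linarith
    then have "\<nu> \<le> 2 / \<kappa> * Q" using \<kappa> by (simp add: field_simps)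
    then show ?thesis using n Q0 by linarith
  next
    case 3
    have "\<mu> / (2 * D) \<le> \<delta>" using 3 D assms(1) by (simp add: \<theta>_def field_simps)
    then have "(\<mu> / (2 * D))\<^sup>2 \<le> \<delta>\<^sup>2" using D assms(1) by (intro power_mono) auto
    then have "(\<mu> / (2 * D))\<^sup>2 \<le> Q" using Q m by linarith
    then have "8 * D\<^sup>2 / \<mu> * (\<mu> / (2 * D))\<^sup>2 \<le> 8 * D\<^sup>2 / \<mu> * Q"
      using assms(1) by (intro mult_left_mono) auto
    moreover have "8 * D\<^sup>2 / \<mu> * (\<mu> / (2 * D))\<^sup>2 = 2 * \<mu>"
      using D assms(1) by (simp add: field_simps power2_eq_square)
    ultimately show ?thesis using 3 n Q0 by linarith
  qed
  then show "\<nu> \<le> (2 + 2 * (a + b * \<mu>) / a + 8 * (a + b * \<mu>)\<^sup>2 / \<mu>) * (\<nu> - c * \<delta> + \<delta>\<^sup>2)"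
    unfolding D_def[symmetric] Q_def[symmetric] k by (simp only: distrib_right)
qed

section \<open>Spectral calculus of the Dirichlet Laplacian\<close>

text \<open>Zorn's lemma provides a witness for the choice in \<open>eigenbasis\<close>: two
  elements of the union of a chain lie in a common member, so orthonormality passes to the
  union.\<close>

lemma eigensystem_eigenbasis: "eigensystem \<Omega> (eigenbasis \<Omega>)"
proof -
  have "\<exists>M\<in>{B. eigensystem \<Omega> B}. \<forall>X\<in>{B. eigensystem \<Omega> B}. M \<subseteq> X \<longrightarrow> X = M"
  proof (rule subset_Zorn')
    fix C assume "subset.chain {B. eigensystem \<Omega> B} C"
    then have sys: "\<And>B. B \<in> C \<Longrightarrow> eigensystem \<Omega> B"
      and chain: "\<And>X Y. X \<in> C \<Longrightarrow> Y \<in> C \<Longrightarrow> X \<subseteq> Y \<or> Y \<subseteq> X"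
      by (auto simp: subset_chain_def)
    have "L2_inner \<Omega> \<phi> \<psi> = (if \<phi> = \<psi> then 1 else 0)"
      if "\<phi> \<in> X" "\<psi> \<in> Y" "X \<in> C" "Y \<in> C" for \<phi> \<psi> X Y
      using chain[OF that(3,4)] sys[OF that(3)] sys[OF that(4)] that(1,2)
      unfolding eigensystem_def by blast
    then have "eigensystem \<Omega> (\<Union>C)"
      using sys unfolding eigensystem_def by blast
    then show "\<Union>C \<in> {B. eigensystem \<Omega> B}" by simp
  qed
  then have "\<exists>B. eigensystem \<Omega> B \<and> (\<forall>B'. eigensystem \<Omega> B' \<and> B \<subseteq> B' \<longrightarrow> B' = B)" by blast
  from someI_ex[OF this] show ?thesis unfolding eigenbasis_def by blast
qed

locale dirichlet_laplacian =
  fixes \<Omega> :: "'a::euclidean_space set" and lam1 :: real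
  assumes domain: "bounded_domain \<Omega>"
    and self_adjoint: "lapA_self_adjoint \<Omega>"
    and pos_def: "lapA_pos_def \<Omega>"
    and smallest: "smallest_eigenvalue \<Omega> lam1"
begin

text \<open>By symmetry \<open>\<mu> (\<phi>, \<phi>) = (\<mu> \<phi>, \<phi>) = (\<phi>, \<nu>
  \<phi>) = \<nu> (\<phi>, \<phi>)\<close>, so the description in \<open>eigenvalue_of\<close> has
  exactly one solution.\<close>

lemma eigenvalue_of_eq:
  assumes \<mu>: "eigenpair \<Omega> \<mu> \<phi>"
  shows "eigenvalue_of \<Omega> \<phi> = \<mu>"
  unfolding eigenvalue_of_def
proof (rule the_equality)
  show "eigenpair \<Omega> \<mu> \<phi>" by (rule \<mu>)
  fix \<nu> assume \<nu>: "eigenpair \<Omega> \<nu> \<phi>"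
  have lap: "lapA \<Omega> \<phi> (\<lambda>x. \<mu> * \<phi> x)" "lapA \<Omega> \<phi> (\<lambda>x. \<nu> * \<phi> x)"
    using \<mu> \<nu> by (auto simp: eigenpair_def)
  then have "\<phi> \<in> L2 \<Omega>" "(\<lambda>x. \<nu> * \<phi> x) \<in> L2 \<Omega>" by (auto simp: lapA_def H10_iff)
  then have "L2_inner \<Omega> (\<lambda>x. \<mu> * \<phi> x) \<phi> = L2_inner \<Omega> \<phi> (\<lambda>x. \<nu> * \<phi> x)"
    using self_adjoint lap unfolding lapA_self_adjoint_def by blast
  then have "\<mu> * L2_inner \<Omega> \<phi> \<phi> = \<nu> * L2_inner \<Omega> \<phi> \<phi>"
    by (simp add: L2_inner_scale_left L2_inner_commute[of \<Omega> \<phi> "\<lambda>x. \<nu> * \<phi> x"])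
  moreover have "L2_inner \<Omega> \<phi> \<phi> \<noteq> 0" using \<mu> by (simp add: eigenpair_def L2_norm_def)
  ultimately show "\<nu> = \<mu>" by simp
qed

lemma lam1_pos: "0 < lam1"
proof -
  obtain \<phi> where "eigenpair \<Omega> lam1 \<phi>" using smallest by (auto simp: smallest_eigenvalue_def)
  then have "0 < L2_inner \<Omega> (\<lambda>x. lam1 * \<phi> x) \<phi>"
    using pos_def unfolding lapA_pos_def_def eigenpair_def by blast
  then have "0 < lam1 * L2_inner \<Omega> \<phi> \<phi>" by (simp add: L2_inner_scale_left)
  then show ?thesis using L2_inner_self_nonneg[of \<Omega> \<phi>] by (simp add: zero_less_mult_iff)
qed

lemma eigenbasisD:
  assumes "\<phi> \<in> eigenbasis \<Omega>"
  shows "lapA \<Omega> \<phi> (\<lambda>x. eigenvalue_of \<Omega> \<phi> * \<phi> x)" and "\<phi> \<in> H10 \<Omega>" and "\<phi> \<in> L2 \<Omega>"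
    and "lam1 \<le> eigenvalue_of \<Omega> \<phi>" and "0 < eigenvalue_of \<Omega> \<phi>"
proof -
  obtain \<mu> where \<mu>: "eigenpair \<Omega> \<mu> \<phi>"
    using eigensystem_eigenbasis assms unfolding eigensystem_def by blast
  show lap: "lapA \<Omega> \<phi> (\<lambda>x. eigenvalue_of \<Omega> \<phi> * \<phi> x)"
    using \<mu> unfolding eigenvalue_of_eq[OF \<mu>] by (simp add: eigenpair_def)
  then show "\<phi> \<in> H10 \<Omega>" "\<phi> \<in> L2 \<Omega>" by (auto simp: lapA_def H10_iff)
  show "lam1 \<le> eigenvalue_of \<Omega> \<phi>"
    using \<mu> smallest unfolding eigenvalue_of_eq[OF \<mu>] smallest_eigenvalue_def by blast
  then show "0 < eigenvalue_of \<Omega> \<phi>" using lam1_pos by linarith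
qed

lemma eigenbasis_orthonormal: "L2_orthonormal \<Omega> (eigenbasis \<Omega>)"
  using eigensystem_eigenbasis[of \<Omega>] eigenbasisD(3)
  unfolding L2_orthonormal_def eigensystem_def by blast

text \<open>Expand \<open>0 \<le> \<Sum>b. \<parallel>k b - s b\<parallel>\<^sup>2\<close>, where \<open>s\<close> is the gradient of the partial eigenfunction expansion.\<close>

lemma H10_Bessel:
  assumes w: "w \<in> L2 \<Omega>" "H10_gradient \<Omega> w k" and F: "finite F" "F \<subseteq> eigenbasis \<Omega>"
  shows "(\<Sum>\<phi>\<in>F. eigenvalue_of \<Omega> \<phi> * (L2_inner \<Omega> w \<phi>)\<^sup>2) \<le> (\<Sum>b\<in>Basis. L2_inner \<Omega> (k b) (k b))"
proof -
  have "\<forall>\<phi>\<in>eigenbasis \<Omega>. \<exists>g. H10_gradient \<Omega> \<phi> g" using eigenbasisD(2) by (auto simp: H10_iff)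
  then obtain G where G: "\<And>\<phi>. \<phi> \<in> eigenbasis \<Omega> \<Longrightarrow> H10_gradient \<Omega> \<phi> (G \<phi>)" by metis
  then have G_weak: "weak_gradient \<Omega> \<phi> (G \<phi>)" if "\<phi> \<in> eigenbasis \<Omega>" for \<phi>
    using that by (simp add: H10_gradient_def)
  have G_L2: "G \<phi> b \<in> L2 \<Omega>" if "\<phi> \<in> F" "b \<in> Basis" for \<phi> b
    using G_weak[of \<phi>] that F(2) by (auto simp: weak_gradient_def)
  define c where "c \<phi> = L2_inner \<Omega> w \<phi>" for \<phi>
  define s where "s b x = (\<Sum>\<phi>\<in>F. c \<phi> * G \<phi> b x)" for b x
  have s_L2: "s b \<in> L2 \<Omega>" if "b \<in> Basis" for b
    unfolding s_def using that by (intro L2_sum L2_scale G_L2)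
  have inner_s: "L2_inner \<Omega> (s b) f = (\<Sum>\<phi>\<in>F. c \<phi> * L2_inner \<Omega> (G \<phi> b) f)"
    if "b \<in> Basis" "f \<in> L2 \<Omega>" for b f
    unfolding s_def using that
    by (subst L2_inner_sum_left) (auto simp: L2_inner_scale_left intro: L2_scale G_L2)
  \<comment> \<open>Green's formula for each eigenfunction in \<open>F\<close> replaces gradients by
    coefficients.\<close>
  have Green: "(\<Sum>b\<in>Basis. L2_inner \<Omega> (s b) (l b)) = (\<Sum>\<phi>\<in>F. c \<phi> * (eigenvalue_of \<Omega> \<phi> * L2_inner \<Omega> v \<phi>))"
    if v: "v \<in> L2 \<Omega>" "H10_gradient \<Omega> v l" for v l
  proof -
    have l: "l b \<in> L2 \<Omega>" if "b \<in> Basis" for b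
      using v(2) that by (auto simp: H10_gradient_def weak_gradient_def)
    have "(\<Sum>b\<in>Basis. L2_inner \<Omega> (s b) (l b)) = (\<Sum>\<phi>\<in>F. c \<phi> * (\<Sum>b\<in>Basis. L2_inner \<Omega> (l b) (G \<phi> b)))"
      by (simp add: inner_s l L2_inner_commute[of \<Omega> "l _"] sum_distrib_left sum.swap[of _ Basis])
    also have "\<dots> = (\<Sum>\<phi>\<in>F. c \<phi> * L2_inner \<Omega> v (\<lambda>x. eigenvalue_of \<Omega> \<phi> * \<phi> x))"
      using F(2) by (intro sum.cong refl arg_cong2[of _ _ _ _ "(*)"]
          H10_Green[OF domain v eigenbasisD(1) G_weak]) auto
    finally show ?thesis
      by (simp add: L2_inner_commute[of \<Omega> v "\<lambda>x. _ * _ x"] L2_inner_scale_left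
          L2_inner_commute[of \<Omega> v])
  qed
  \<comment> \<open>\<open>Green\<close> with \<open>v = w\<close> gives \<open>Q\<close> for the
    cross term; with \<open>v\<close> running through the eigenfunctions in \<open>F\<close>,
    orthonormality gives \<open>Q\<close> for the square of \<open>s\<close> as well.\<close>
  define Q where "Q = (\<Sum>\<phi>\<in>F. eigenvalue_of \<Omega> \<phi> * (c \<phi>)\<^sup>2)"
  have sk: "(\<Sum>b\<in>Basis. L2_inner \<Omega> (s b) (k b)) = Q"
    unfolding Green[OF w] Q_def by (simp add: c_def power2_eq_square mult_ac)
  have "(\<Sum>b\<in>Basis. L2_inner \<Omega> (s b) (s b)) = (\<Sum>\<phi>\<in>F. c \<phi> * (\<Sum>b\<in>Basis. L2_inner \<Omega> (s b) (G \<phi> b)))"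
    using s_L2
    by (simp add: inner_s[of _ "s _"] L2_inner_commute[of \<Omega> "G _ _"] sum_distrib_left
        sum.swap[of _ Basis])
  also have "\<dots> = (\<Sum>\<phi>\<in>F. c \<phi> * (eigenvalue_of \<Omega> \<phi> * c \<phi>))"
  proof (intro sum.cong refl arg_cong2[of _ _ _ _ "(*)"])
    fix \<phi> assume \<phi>: "\<phi> \<in> F"
    then have \<phi>B: "\<phi> \<in> eigenbasis \<Omega>" using F(2) by auto
    have "(\<Sum>b\<in>Basis. L2_inner \<Omega> (s b) (G \<phi> b))
        = (\<Sum>\<psi>\<in>F. c \<psi> * (eigenvalue_of \<Omega> \<psi> * L2_inner \<Omega> \<phi> \<psi>))"
      by (rule Green[OF eigenbasisD(3)[OF \<phi>B] G[OF \<phi>B]])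
    also have "\<dots> = (\<Sum>\<psi>\<in>F. if \<phi> = \<psi> then eigenvalue_of \<Omega> \<psi> * c \<psi> else 0)"
      using eigenbasis_orthonormal F(2) \<phi>B
      by (intro sum.cong) (auto simp: L2_orthonormal_def subset_iff)
    finally show "(\<Sum>b\<in>Basis. L2_inner \<Omega> (s b) (G \<phi> b)) = eigenvalue_of \<Omega> \<phi> * c \<phi>"
      using F(1) \<phi> by simp
  qed
  finally have ss: "(\<Sum>b\<in>Basis. L2_inner \<Omega> (s b) (s b)) = Q"
    by (simp add: Q_def power2_eq_square mult_ac)
  have k: "k b \<in> L2 \<Omega>" if "b \<in> Basis" for b
    using w(2) that by (auto simp: H10_gradient_def weak_gradient_def)
  have "0 \<le> (\<Sum>b\<in>Basis. L2_inner \<Omega> (\<lambda>x. k b x - s b x) (\<lambda>x. k b x - s b x))"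
    by (intro sum_nonneg L2_inner_self_nonneg)
  also have "\<dots> = (\<Sum>b\<in>Basis. L2_inner \<Omega> (k b) (k b) - 2 * L2_inner \<Omega> (s b) (k b) + L2_inner \<Omega> (s b) (s b))"
    by (intro sum.cong refl)
      (simp add: L2_inner_diff_left L2_inner_diff_right L2_diff k s_L2 L2_inner_commute[of \<Omega> "k _" "s _"])
  also have "\<dots> = (\<Sum>b\<in>Basis. L2_inner \<Omega> (k b) (k b)) - Q"
    by (simp add: sum.distrib sum_subtractf sum_distrib_left[symmetric] ss sk)
  finally show ?thesis by (simp add: Q_def c_def)
qed

section \<open>Fractional powers through eigenfunction coefficients\<close>

lemma powA_graphD:
  assumes "powA_graph \<Omega> s v w"
  shows "v \<in> L2 \<Omega>" and "w \<in> L2 \<Omega>"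
    and "\<And>\<phi>. \<phi> \<in> eigenbasis \<Omega> \<Longrightarrow>
      L2_inner \<Omega> w \<phi> = eigenvalue_of \<Omega> \<phi> powr s * L2_inner \<Omega> v \<phi>"
    and "((\<lambda>\<phi>. (eigenvalue_of \<Omega> \<phi> powr s * L2_inner \<Omega> v \<phi>)\<^sup>2) has_sum (L2_norm \<Omega> w)\<^sup>2)
      (eigenbasis \<Omega>)"
proof -
  note g = assms[unfolded powA_graph_def]
  from g show "v \<in> L2 \<Omega>" and w: "w \<in> L2 \<Omega>" by auto
  \<comment> \<open>Norm convergence of the expansion is part of the graph, so coefficients and
    Parseval's identity for the image both follow from it.\<close>
  note L = L2_expansion_limit[OF eigenbasis_orthonormal w,
      of "\<lambda>\<phi>. eigenvalue_of \<Omega> \<phi> powr s * L2_inner \<Omega> v \<phi>"]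
  show "L2_inner \<Omega> w \<phi> = eigenvalue_of \<Omega> \<phi> powr s * L2_inner \<Omega> v \<phi>"
    if "\<phi> \<in> eigenbasis \<Omega>" for \<phi>
    using L(1) g that by auto
  show "((\<lambda>\<phi>. (eigenvalue_of \<Omega> \<phi> powr s * L2_inner \<Omega> v \<phi>)\<^sup>2) has_sum (L2_norm \<Omega> w)\<^sup>2)
      (eigenbasis \<Omega>)"
    using L(2) g by auto
qed

lemma powA_graph_powA:
  assumes "v \<in> dom_powA \<Omega> s"
  shows "powA_graph \<Omega> s v (powA \<Omega> s v)"
proof -
  from assms have "\<exists>w. powA_graph \<Omega> s v w" by (simp add: dom_powA_def)
  from someI_ex[OF this] show ?thesis by (simp add: powA_def)
qed

lemma powr_coeff_power2:
  assumes "\<phi> \<in> eigenbasis \<Omega>"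
  shows "(eigenvalue_of \<Omega> \<phi> powr s * c)\<^sup>2 = eigenvalue_of \<Omega> \<phi> powr (2 * s) * c\<^sup>2"
  using eigenbasisD(5)[OF assms] by (simp add: power_mult_distrib powr_power mult.commute)

text \<open>Riesz-Fischer builds the image from its coefficients; conversely Parseval's identity for
  the image gives the summability. Membership thus becomes a condition on the coefficients
  alone.\<close>

lemma dom_powA_iff:
  assumes v: "v \<in> L2 \<Omega>"
  shows "v \<in> dom_powA \<Omega> s \<longleftrightarrow>
    (\<lambda>\<phi>. eigenvalue_of \<Omega> \<phi> powr (2 * s) * (L2_inner \<Omega> v \<phi>)\<^sup>2) summable_on (eigenbasis \<Omega>)"
proof -
  have "(\<lambda>\<phi>. eigenvalue_of \<Omega> \<phi> powr (2 * s) * (L2_inner \<Omega> v \<phi>)\<^sup>2) summable_on (eigenbasis \<Omega>)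
    \<longleftrightarrow> (\<lambda>\<phi>. (eigenvalue_of \<Omega> \<phi> powr s * L2_inner \<Omega> v \<phi>)\<^sup>2) summable_on (eigenbasis \<Omega>)"
    by (intro summable_on_cong) (simp add: powr_coeff_power2)
  also have "\<dots> \<longleftrightarrow> v \<in> dom_powA \<Omega> s"
  proof
    assume "(\<lambda>\<phi>. (eigenvalue_of \<Omega> \<phi> powr s * L2_inner \<Omega> v \<phi>)\<^sup>2) summable_on (eigenbasis \<Omega>)"
    from Riesz_Fischer[OF eigenbasis_orthonormal this] show "v \<in> dom_powA \<Omega> s"
      using v unfolding dom_powA_def powA_graph_def by blast
  next
    assume "v \<in> dom_powA \<Omega> s"
    from powA_graphD(4)[OF powA_graph_powA[OF this]]
    show "(\<lambda>\<phi>. (eigenvalue_of \<Omega> \<phi> powr s * L2_inner \<Omega> v \<phi>)\<^sup>2) summable_on (eigenbasis \<Omega>)"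
      by (rule has_sum_imp_summable)
  qed
  finally show ?thesis by simp
qed

lemma normA_has_sum:
  assumes "v \<in> dom_powA \<Omega> (s / 2)"
  shows "((\<lambda>\<phi>. eigenvalue_of \<Omega> \<phi> powr s * (L2_inner \<Omega> v \<phi>)\<^sup>2) has_sum (normA \<Omega> s v)\<^sup>2) (eigenbasis \<Omega>)"
proof -
  have "((\<lambda>\<phi>. (eigenvalue_of \<Omega> \<phi> powr (s / 2) * L2_inner \<Omega> v \<phi>)\<^sup>2) has_sum (normA \<Omega> s v)\<^sup>2)
      (eigenbasis \<Omega>)"
    unfolding normA_def by (rule powA_graphD(4)[OF powA_graph_powA[OF assms]])
  then show ?thesis
    by (rule has_sum_cong[THEN iffD1, rotated]) (simp add: powr_coeff_power2)
qed

text \<open>Bessel's inequality for gradients bounds the partial sums. Hence the square root of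
  \<open>A\<close> in \<open>formA\<close> is a genuine image, not an arbitrary choice, for
  arguments in \<open>H10\<close>.\<close>

lemma H10_dom_powA:
  assumes "w \<in> H10 \<Omega>"
  shows "w \<in> dom_powA \<Omega> (1 / 2)"
proof -
  obtain k where w: "w \<in> L2 \<Omega>" "H10_gradient \<Omega> w k" using assms by (auto simp: H10_iff)
  have "(\<lambda>\<phi>. eigenvalue_of \<Omega> \<phi> * (L2_inner \<Omega> w \<phi>)\<^sup>2) summable_on (eigenbasis \<Omega>)"
  proof (rule nonneg_bounded_partial_sums_imp_summable_on)
    show "\<forall>\<^sub>F F in finite_subsets_at_top (eigenbasis \<Omega>).
        (\<Sum>\<phi>\<in>F. eigenvalue_of \<Omega> \<phi> * (L2_inner \<Omega> w \<phi>)\<^sup>2) \<le> (\<Sum>b\<in>Basis. L2_inner \<Omega> (k b) (k b))"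
      by (intro eventually_finite_subsets_at_top_weakI H10_Bessel[OF w])
  qed (simp add: eigenbasisD(5) less_imp_le)
  then show ?thesis
    unfolding dom_powA_iff[OF w(1)]
    by (rule summable_on_cong[THEN iffD1, rotated]) (simp add: eigenbasisD(5) less_imp_le)
qed

text \<open>The expansion of the square root of \<open>A\<close> at \<phi> reduces to
  \<open>\<nu>^(1/2) \<phi>\<close> once the finite set contains \<phi>. As \<open>powA\<close>
  picks some representative, this is read off from pairings with the root at \<open>w\<close>, whose
  own coefficient supplies the second factor \<open>\<nu>^(1/2)\<close>.\<close>

lemma formA_eigenbasis:
  assumes w: "w \<in> H10 \<Omega>" and \<phi>: "\<phi> \<in> eigenbasis \<Omega>"
  shows "formA \<Omega> w \<phi> = eigenvalue_of \<Omega> \<phi> * L2_inner \<Omega> w \<phi>"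
proof -
  let ?r = "eigenvalue_of \<Omega> \<phi> powr (1 / 2)"
  note gw = powA_graph_powA[OF H10_dom_powA[OF w]]
  note g\<phi> = powA_graph_powA[OF H10_dom_powA[OF eigenbasisD(2)[OF \<phi>]]]
  let ?S = "\<lambda>F x. \<Sum>\<psi>\<in>F. eigenvalue_of \<Omega> \<psi> powr (1 / 2) * L2_inner \<Omega> \<phi> \<psi> * \<psi> x"
  have "L2_inner \<Omega> (powA \<Omega> (1 / 2) \<phi>) (powA \<Omega> (1 / 2) w) = ?r * L2_inner \<Omega> \<phi> (powA \<Omega> (1 / 2) w)"
  proof (rule tendsto_unique[OF finite_subsets_at_top_neq_bot])
    show "((\<lambda>F. L2_inner \<Omega> (?S F) (powA \<Omega> (1 / 2) w)) \<longlongrightarrow>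
        L2_inner \<Omega> (powA \<Omega> (1 / 2) \<phi>) (powA \<Omega> (1 / 2) w)) (finite_subsets_at_top (eigenbasis \<Omega>))"
      using g\<phi> unfolding powA_graph_def
      by (intro tendsto_L2_inner_left eventually_finite_subsets_at_top_weakI
          L2_expansion[OF eigenbasis_orthonormal] powA_graphD(2)[OF gw]) auto
    have "?S F = (\<lambda>x. ?r * \<phi> x)" if "finite F" "\<phi> \<in> F" "F \<subseteq> eigenbasis \<Omega>" for F
    proof
      fix x
      have "?S F x = (\<Sum>\<psi>\<in>F. if \<phi> = \<psi> then eigenvalue_of \<Omega> \<psi> powr (1 / 2) * \<psi> x else 0)"
        using eigenbasis_orthonormal that \<phi>
        by (intro sum.cong) (auto simp: L2_orthonormal_def subset_iff)
      then show "?S F x = ?r * \<phi> x" using that by simp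
    qed
    then have "L2_inner \<Omega> (?S F) (powA \<Omega> (1 / 2) w) = ?r * L2_inner \<Omega> \<phi> (powA \<Omega> (1 / 2) w)"
      if "finite F" "\<phi> \<in> F" "F \<subseteq> eigenbasis \<Omega>" for F
      using that by (simp only: L2_inner_scale_left)
    then have "\<forall>\<^sub>F F in finite_subsets_at_top (eigenbasis \<Omega>). L2_inner \<Omega> (?S F) (powA \<Omega> (1 / 2) w)
        = ?r * L2_inner \<Omega> \<phi> (powA \<Omega> (1 / 2) w)"
      unfolding eventually_finite_subsets_at_top using \<phi> by (intro exI[of _ "{\<phi>}"]) blast
    then show "((\<lambda>F. L2_inner \<Omega> (?S F) (powA \<Omega> (1 / 2) w)) \<longlongrightarrow>
        ?r * L2_inner \<Omega> \<phi> (powA \<Omega> (1 / 2) w)) (finite_subsets_at_top (eigenbasis \<Omega>))"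
      by (rule tendsto_eventually)
  qed
  moreover have "?r * ?r = eigenvalue_of \<Omega> \<phi>"
    using eigenbasisD(5)[OF \<phi>] by (simp flip: powr_add)
  ultimately show ?thesis
    using powA_graphD(3)[OF gw \<phi>]
    by (simp add: formA_def L2_inner_commute[of \<Omega> _ "powA \<Omega> (1 / 2) w"] flip: mult.assoc)
qed

text \<open>Difference quotients converge in norm, hence after pairing with \<phi>. The equation may
  be tested with \<phi> because eigenfunctions lie in \<open>H10\<close>, and there the form acts as
  multiplication by the eigenvalue.\<close>

lemma variational_solution_mode:
  assumes sol: "variational_solution \<Omega> \<alpha> \<beta> u0 u1 u u'" and \<phi>: "\<phi> \<in> eigenbasis \<Omega>"
  shows "\<And>t. t \<ge> 0 \<Longrightarrow>
      ((\<lambda>s. L2_inner \<Omega> (u s) \<phi>) has_real_derivative L2_inner \<Omega> (u' t) \<phi>) (at t within {0..})"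
    and "\<And>t. t > 0 \<Longrightarrow> ((\<lambda>s. L2_inner \<Omega> (u' s) \<phi>) has_real_derivative
      - ((\<alpha> t + \<beta> t * eigenvalue_of \<Omega> \<phi>) * L2_inner \<Omega> (u' t) \<phi> + eigenvalue_of \<Omega> \<phi> * L2_inner \<Omega> (u t) \<phi>)) (at t)"
proof -
  have L2: "u t \<in> L2 \<Omega>" "u' t \<in> L2 \<Omega>" if "t \<ge> 0" for t
    using sol that by (auto simp: variational_solution_def L2_time_deriv_def)
  note \<phi>L2 = eigenbasisD(3)[OF \<phi>]
  show "((\<lambda>s. L2_inner \<Omega> (u s) \<phi>) has_real_derivative L2_inner \<Omega> (u' t) \<phi>) (at t within {0..})"
    if t: "t \<ge> 0" for t
    unfolding has_field_derivative_iff
  proof (rule Lim_transform2[OF tendsto_const], rule Lim_null_comparison)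
    have "((\<lambda>s. L2_norm \<Omega> (\<lambda>x. (u s x - u t x) / (s - t) - u' t x)) \<longlongrightarrow> 0) (at t within {0..})"
      using sol t by (auto simp: variational_solution_def L2_time_deriv_def)
    from tendsto_mult[OF this tendsto_const, of "L2_norm \<Omega> \<phi>"]
    show "((\<lambda>s. L2_norm \<Omega> (\<lambda>x. (u s x - u t x) / (s - t) - u' t x) * L2_norm \<Omega> \<phi>) \<longlongrightarrow> 0)
        (at t within {0..})" by simp
    show "\<forall>\<^sub>F s in at t within {0..}.
        norm (L2_inner \<Omega> (u' t) \<phi> - (L2_inner \<Omega> (u s) \<phi> - L2_inner \<Omega> (u t) \<phi>) / (s - t))
        \<le> L2_norm \<Omega> (\<lambda>x. (u s x - u t x) / (s - t) - u' t x) * L2_norm \<Omega> \<phi>"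
    proof (rule eventually_at_topological[THEN iffD2], intro exI[of _ UNIV] conjI ballI impI)
      fix s :: real assume s: "s \<in> {0..}"
      have q: "(\<lambda>x. (u s x - u t x) / (s - t)) \<in> L2 \<Omega>"
        using L2_scale[OF L2_diff[OF L2(1)[of s] L2(1)[OF t]], of "1 / (s - t)"] s by simp
      have "L2_inner \<Omega> (\<lambda>x. (u s x - u t x) / (s - t) - u' t x) \<phi>
          = (L2_inner \<Omega> (u s) \<phi> - L2_inner \<Omega> (u t) \<phi>) / (s - t) - L2_inner \<Omega> (u' t) \<phi>"
        using L2_inner_scale_left[of \<Omega> "1 / (s - t)" "\<lambda>x. u s x - u t x" \<phi>] s t
        by (simp add: L2_inner_diff_left q L2 \<phi>L2)
      then show "norm (L2_inner \<Omega> (u' t) \<phi> - (L2_inner \<Omega> (u s) \<phi> - L2_inner \<Omega> (u t) \<phi>) / (s - t))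
          \<le> L2_norm \<Omega> (\<lambda>x. (u s x - u t x) / (s - t) - u' t x) * L2_norm \<Omega> \<phi>"
        using L2_inner_Cauchy_Schwarz[OF L2_diff[OF q L2(2)[OF t]] \<phi>L2] by (simp add: abs_minus_commute)
    qed auto
  qed
  show "((\<lambda>s. L2_inner \<Omega> (u' s) \<phi>) has_real_derivative
      - ((\<alpha> t + \<beta> t * eigenvalue_of \<Omega> \<phi>) * L2_inner \<Omega> (u' t) \<phi> + eigenvalue_of \<Omega> \<phi> * L2_inner \<Omega> (u t) \<phi>)) (at t)"
    if t: "t > 0" for t
  proof -
    obtain d where d: "((\<lambda>s. L2_inner \<Omega> (u' s) \<phi>) has_real_derivative d) (at t)"
      and eq: "d + \<beta> t * formA \<Omega> (u' t) \<phi> + \<alpha> t * L2_inner \<Omega> (u' t) \<phi> + formA \<Omega> (u t) \<phi> = 0"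
      using sol t eigenbasisD(2)[OF \<phi>] unfolding variational_solution_def by blast
    have "u t \<in> H10 \<Omega>" "u' t \<in> H10 \<Omega>" using sol t by (auto simp: variational_solution_def)
    with eq have "d = - ((\<alpha> t + \<beta> t * eigenvalue_of \<Omega> \<phi>) * L2_inner \<Omega> (u' t) \<phi>
        + eigenvalue_of \<Omega> \<phi> * L2_inner \<Omega> (u t) \<phi>)"
      by (simp add: formA_eigenbasis \<phi> algebra_simps)
    with d show ?thesis by simp
  qed
qed

text \<open>Since \<open>\<nu>^(2j) = \<nu>^(2j-1) \<nu>\<close>, both norms share one weight and
  each summand is a weighted oscillator energy.\<close>

lemma energyA_has_sum:
  assumes "u t \<in> dom_powA \<Omega> j" "u' t \<in> dom_powA \<Omega> (j - 1/2)"
  shows "((\<lambda>\<phi>. eigenvalue_of \<Omega> \<phi> powr (2 * j - 1) *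
      ((L2_inner \<Omega> (u' t) \<phi>)\<^sup>2 + eigenvalue_of \<Omega> \<phi> * (L2_inner \<Omega> (u t) \<phi>)\<^sup>2))
    has_sum 2 * energyA \<Omega> j u u' t) (eigenbasis \<Omega>)"
proof -
  have "u t \<in> dom_powA \<Omega> (2 * j / 2)" "u' t \<in> dom_powA \<Omega> ((2 * j - 1) / 2)"
    using assms by (simp_all add: diff_divide_distrib)
  note add = has_sum_add[OF normA_has_sum[OF this(2)] normA_has_sum[OF this(1)]]
  have "2 * energyA \<Omega> j u u' t = (normA \<Omega> (2 * j - 1) (u' t))\<^sup>2 + (normA \<Omega> (2 * j) (u t))\<^sup>2"
    by (simp add: energyA_def)
  with add
  have sum: "((\<lambda>\<phi>. eigenvalue_of \<Omega> \<phi> powr (2 * j - 1) * (L2_inner \<Omega> (u' t) \<phi>)\<^sup>2 +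
      eigenvalue_of \<Omega> \<phi> powr (2 * j) * (L2_inner \<Omega> (u t) \<phi>)\<^sup>2)
    has_sum 2 * energyA \<Omega> j u u' t) (eigenbasis \<Omega>)" by simp
  have "eigenvalue_of \<Omega> \<phi> powr (2 * j) = eigenvalue_of \<Omega> \<phi> powr (2 * j - 1) * eigenvalue_of \<Omega> \<phi>"
    if "\<phi> \<in> eigenbasis \<Omega>" for \<phi>
    using eigenbasisD(5)[OF that] by (simp add: powr_diff)
  then show ?thesis
    by (intro has_sum_cong[THEN iffD1, OF _ sum]) (simp add: distrib_left mult.assoc)
qed

end

section \<open>Energy decay\<close>

text \<open>The modewise bound has a factor independent of the mode, so it survives weighted
  summation. It also propagates regularity: the series at time \<open>t\<close> is dominated by the
  convergent series at time 0.\<close>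

lemma (in dirichlet_laplacian) energy_decay:
  fixes \<alpha>min \<alpha>max \<beta>min \<beta>max :: real
  assumes \<alpha>: "0 < \<alpha>min" "\<And>t. t \<ge> 0 \<Longrightarrow> \<alpha>min \<le> \<alpha> t \<and> \<alpha> t \<le> \<alpha>max"
    and \<beta>: "0 < \<beta>min" "\<And>t. t \<ge> 0 \<Longrightarrow> \<beta>min \<le> \<beta> t \<and> \<beta> t \<le> \<beta>max"
    and \<alpha>': "\<And>t. t \<ge> 0 \<Longrightarrow> (\<alpha> has_real_derivative \<alpha>' t) (at t within {0..}) \<and> \<alpha>' t \<ge> 0"
    and \<beta>': "\<And>t. t \<ge> 0 \<Longrightarrow> (\<beta> has_real_derivative \<beta>' t) (at t within {0..}) \<and> \<beta>' t \<ge> 0"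
    and u0: "u0 \<in> dom_powA \<Omega> j" and u1: "u1 \<in> dom_powA \<Omega> (j - 1/2)"
    and sol: "variational_solution \<Omega> \<alpha> \<beta> u0 u1 u u'"
    and \<delta>: "0 < \<delta>" "\<delta> \<le> (\<alpha>min + \<beta>min * lam1) / 2" "\<delta> \<le> lam1 / (\<alpha>max + \<beta>max * lam1)"
    and K: "K = 2 + 2 * (\<alpha>max + \<beta>max * lam1) / \<alpha>max + 8 * (\<alpha>max + \<beta>max * lam1)\<^sup>2 / lam1"
    and t: "t \<ge> 0"
  shows "u t \<in> dom_powA \<Omega> j" and "u' t \<in> dom_powA \<Omega> (j - 1/2)"
    and "energyA \<Omega> j u u' t \<le> (4 + 2 * K) * exp (- 2 * \<delta> * t) * energyA \<Omega> j u u' 0"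
proof -
  let ?B = "eigenbasis \<Omega>" and ?ev = "eigenvalue_of \<Omega>"
  define e where "e s \<phi> = ?ev \<phi> powr (2 * j - 1) *
      ((L2_inner \<Omega> (u' s) \<phi>)\<^sup>2 + ?ev \<phi> * (L2_inner \<Omega> (u s) \<phi>)\<^sup>2)" for s \<phi>
  define c where "c = (4 + 2 * K) * exp (- 2 * \<delta> * t)"
  have max_pos: "0 < \<alpha>max" "0 \<le> \<beta>max" using \<alpha>(1) \<alpha>(2)[of 0] \<beta>(1) \<beta>(2)[of 0] by auto
  have L2: "u s \<in> L2 \<Omega>" "u' s \<in> L2 \<Omega>" if "s \<ge> 0" for s
    using sol that by (auto simp: variational_solution_def L2_time_deriv_def)
  have e_le: "e t \<phi> \<le> c * e 0 \<phi>" if \<phi>: "\<phi> \<in> ?B" for \<phi>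
  proof -
    note ev = eigenbasisD(4,5)[OF \<phi>]
    define a where "a s = \<alpha> s + \<beta> s * ?ev \<phi>" for s
    have a_le: "a s \<le> \<alpha>max + \<beta>max * ?ev \<phi>" and a_ge: "2 * \<delta> \<le> a s" if "s \<ge> 0" for s
    proof -
      show "a s \<le> \<alpha>max + \<beta>max * ?ev \<phi>"
        unfolding a_def using \<alpha>(2)[OF that] \<beta>(2)[OF that] ev by (intro add_mono mult_right_mono) auto
      have "\<alpha>min + \<beta>min * lam1 \<le> a s"
        unfolding a_def using \<alpha>(2)[OF that] \<beta>(1) \<beta>(2)[OF that] ev lam1_pos
        by (intro add_mono mult_mono) auto
      then show "2 * \<delta> \<le> a s" using \<delta>(2) by simp
    qed
    \<comment> \<open>The upper bounds on \<alpha> and \<beta> control the damping from above, with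
      \<open>lam1\<close> as the least stiffness; the resulting \<open>K\<close> is the same for all
      modes and times.\<close>
    note st = stiffness_lower_bound[OF lam1_pos ev(1) max_pos a_le \<delta>(1,3)]
    have "(L2_inner \<Omega> (u' t) \<phi>)\<^sup>2 + ?ev \<phi> * (L2_inner \<Omega> (u t) \<phi>)\<^sup>2
      \<le> c * ((L2_inner \<Omega> (u' 0) \<phi>)\<^sup>2 + ?ev \<phi> * (L2_inner \<Omega> (u 0) \<phi>)\<^sup>2)"
      unfolding c_def
    proof (rule damped_oscillator_decay[where a = a and a' = "\<lambda>s. \<alpha>' s + \<beta>' s * ?ev \<phi>"])
      show "(a has_real_derivative \<alpha>' s + \<beta>' s * ?ev \<phi>) (at s within {0..})" if "s \<ge> 0" for s
        unfolding a_def using \<alpha>'[OF that] \<beta>'[OF that] by (auto intro!: derivative_eq_intros)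
      show "0 \<le> \<alpha>' s + \<beta>' s * ?ev \<phi>" if "s \<ge> 0" for s
        using \<alpha>'[OF that] \<beta>'[OF that] ev by auto
      show "?ev \<phi> \<le> K * (?ev \<phi> - a s * \<delta> + \<delta>\<^sup>2)" if "s \<ge> 0" for s
        unfolding K by (rule st(2)[OF that])
    qed (use variational_solution_mode[OF sol \<phi>] st(1) a_ge \<delta>(1) t in \<open>simp_all add: a_def\<close>)
    then have "e t \<phi> \<le> ?ev \<phi> powr (2 * j - 1) *
        (c * ((L2_inner \<Omega> (u' 0) \<phi>)\<^sup>2 + ?ev \<phi> * (L2_inner \<Omega> (u 0) \<phi>)\<^sup>2))"
      unfolding e_def by (intro mult_left_mono) auto
    then show ?thesis by (simp add: e_def mult_ac)
  qed
  \<comment> \<open>The initial data are attained only almost everywhere, which the coefficients do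
    not see.\<close>
  have init: "L2_inner \<Omega> (u 0) \<phi> = L2_inner \<Omega> u0 \<phi>" "L2_inner \<Omega> (u' 0) \<phi> = L2_inner \<Omega> u1 \<phi>"
    if "\<phi> \<in> ?B" for \<phi>
    using sol L2[of 0] powA_graphD(1)[OF powA_graph_powA[OF u0]] powA_graphD(1)[OF powA_graph_powA[OF u1]]
      eigenbasisD(3)[OF that]
    by (auto simp: variational_solution_def intro: L2_inner_cong_AE)
  have "u 0 \<in> dom_powA \<Omega> j \<longleftrightarrow> u0 \<in> dom_powA \<Omega> j"
    "u' 0 \<in> dom_powA \<Omega> (j - 1/2) \<longleftrightarrow> u1 \<in> dom_powA \<Omega> (j - 1/2)"
    using L2[of 0] powA_graphD(1)[OF powA_graph_powA[OF u0]] powA_graphD(1)[OF powA_graph_powA[OF u1]]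
    by (auto simp: dom_powA_iff init intro!: summable_on_cong[THEN iffD1, rotated] cong: summable_on_cong)
  with u0 u1 have "(e 0 has_sum 2 * energyA \<Omega> j u u' 0) ?B"
    unfolding e_def[abs_def] by (intro energyA_has_sum) auto
  then have sum0: "((\<lambda>\<phi>. c * e 0 \<phi>) has_sum c * (2 * energyA \<Omega> j u u' 0)) ?B"
    by (rule has_sum_cmult_right)
  \<comment> \<open>Each half of the mode energy is dominated separately, because membership of
    \<open>u t\<close> and \<open>u' t\<close> in the domains must be known before the energy at
    \<open>t\<close> can be written as a sum.\<close>
  have parts: "?ev \<phi> powr (2 * (j - 1/2)) * (L2_inner \<Omega> (u' t) \<phi>)\<^sup>2 \<le> e t \<phi>"
    "?ev \<phi> powr (2 * j) * (L2_inner \<Omega> (u t) \<phi>)\<^sup>2 \<le> e t \<phi>" if "\<phi> \<in> ?B" for \<phi>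
  proof -
    have "?ev \<phi> powr (2 * j) = ?ev \<phi> powr (2 * j - 1) * ?ev \<phi>"
      using eigenbasisD(5)[OF that] by (simp add: powr_diff)
    then show "?ev \<phi> powr (2 * (j - 1/2)) * (L2_inner \<Omega> (u' t) \<phi>)\<^sup>2 \<le> e t \<phi>"
      "?ev \<phi> powr (2 * j) * (L2_inner \<Omega> (u t) \<phi>)\<^sup>2 \<le> e t \<phi>"
      using eigenbasisD(5)[OF that] by (simp_all add: e_def distrib_left mult.assoc right_diff_distrib)
  qed
  have "(\<lambda>\<phi>. ?ev \<phi> powr (2 * j) * (L2_inner \<Omega> (u t) \<phi>)\<^sup>2) summable_on ?B"
    by (rule summable_on_comparison_test[OF has_sum_imp_summable[OF sum0]])
      (use order_trans[OF parts(2) e_le] in auto)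
  then show ut: "u t \<in> dom_powA \<Omega> j" by (simp add: dom_powA_iff L2 t)
  have "(\<lambda>\<phi>. ?ev \<phi> powr (2 * (j - 1/2)) * (L2_inner \<Omega> (u' t) \<phi>)\<^sup>2) summable_on ?B"
    by (rule summable_on_comparison_test[OF has_sum_imp_summable[OF sum0]])
      (use order_trans[OF parts(1) e_le] in auto)
  then show ut': "u' t \<in> dom_powA \<Omega> (j - 1/2)" unfolding dom_powA_iff[OF L2(2)[OF t]] .
  have "(e t has_sum 2 * energyA \<Omega> j u u' t) ?B"
    unfolding e_def[abs_def] by (intro energyA_has_sum ut ut')
  from has_sum_mono[OF this sum0 e_le]
  show "energyA \<Omega> j u u' t \<le> (4 + 2 * K) * exp (- 2 * \<delta> * t) * energyA \<Omega> j u u' 0"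
    by (simp add: c_def)
qed

text \<open>In the equality cases \<delta> is the smaller of the two bounds, hence the remaining
  inequality as a side condition: an overdamped first mode decays more slowly than half its damping
  rate. The constants are quantified before \<open>j\<close>, \<delta> and the data.\<close>

theorem theorem5p2:
  fixes \<Omega> :: "'a::euclidean_space set"
    and \<alpha> \<beta> \<alpha>' \<beta>' :: "real \<Rightarrow> real"
    and \<alpha>min \<alpha>max \<beta>min \<beta>max lam1 :: real
  assumes "bounded_domain \<Omega>"
    and "lapA_self_adjoint \<Omega>"
    and "lapA_pos_def \<Omega>"
    and "smallest_eigenvalue \<Omega> lam1"
    and "0 < \<alpha>min" and "\<And>t. t \<ge> 0 \<Longrightarrow> \<alpha>min \<le> \<alpha> t \<and> \<alpha> t \<le> \<alpha>max"
    and "0 < \<beta>min" and "\<And>t. t \<ge> 0 \<Longrightarrow> \<beta>min \<le> \<beta> t \<and> \<beta> t \<le> \<beta>max"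
    and "\<And>t. t \<ge> 0 \<Longrightarrow> (\<alpha> has_real_derivative \<alpha>' t) (at t within {0..}) \<and> \<alpha>' t \<ge> 0"
    and "\<And>t. t \<ge> 0 \<Longrightarrow> (\<beta> has_real_derivative \<beta>' t) (at t within {0..}) \<and> \<beta>' t \<ge> 0"
  shows "(\<exists>C>0. \<forall>j \<delta> u0 u1 u u'.
           j \<ge> 1/2 \<and> u0 \<in> dom_powA \<Omega> j \<and> u1 \<in> dom_powA \<Omega> (j - 1/2) \<and>
           variational_solution \<Omega> \<alpha> \<beta> u0 u1 u u' \<and>
           (0 < \<delta> \<and> \<delta> < min ((\<alpha>min + \<beta>min * lam1) / 2) (lam1 / (\<alpha>max + \<beta>max * lam1)) \<or>
            0 < \<delta> \<and> \<delta> = (\<alpha>min + \<beta>min * lam1) / 2 \<and> \<delta> \<le> lam1 / (\<alpha>max + \<beta>max * lam1)) \<longrightarrow>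
           (\<forall>t\<ge>0. u t \<in> dom_powA \<Omega> j \<and> u' t \<in> dom_powA \<Omega> (j - 1/2) \<and>
                  energyA \<Omega> j u u' t \<le> C * exp (- 2 * \<delta> * t) * energyA \<Omega> j u u' 0))
       \<and> (\<exists>C>0. \<forall>j \<delta> u0 u1 u u'.
           j \<ge> 1/2 \<and> u0 \<in> dom_powA \<Omega> j \<and> u1 \<in> dom_powA \<Omega> (j - 1/2) \<and>
           variational_solution \<Omega> \<alpha> \<beta> u0 u1 u u' \<and>
           0 < \<delta> \<and> \<delta> = lam1 / (\<alpha>max + \<beta>max * lam1) \<and> \<delta> \<le> (\<alpha>min + \<beta>min * lam1) / 2 \<longrightarrow>
           (\<forall>t\<ge>0. u' t \<in> dom_powA \<Omega> (j - 1/2) \<and>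
                  (normA \<Omega> (2*j - 1) (u' t))\<^sup>2 \<le> C * exp (- 2 * \<delta> * t) * energyA \<Omega> j u u' 0))"
proof -
  interpret dirichlet_laplacian \<Omega> lam1 by unfold_locales fact+
  define K where "K = 2 + 2 * (\<alpha>max + \<beta>max * lam1) / \<alpha>max + 8 * (\<alpha>max + \<beta>max * lam1)\<^sup>2 / lam1"
  have "0 < \<alpha>max" "0 \<le> \<beta>max" using assms(5) assms(6)[of 0] assms(7) assms(8)[of 0] by auto
  then have "0 \<le> K" using lam1_pos by (auto simp: K_def intro!: add_nonneg_nonneg)
  \<comment> \<open>All admissible ranges of \<delta> lie in the closed region where both upper
    bounds hold.\<close>
  have decay: "u t \<in> dom_powA \<Omega> j" "u' t \<in> dom_powA \<Omega> (j - 1/2)"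
    "energyA \<Omega> j u u' t \<le> (4 + 2 * K) * exp (- 2 * \<delta> * t) * energyA \<Omega> j u u' 0"
    if "u0 \<in> dom_powA \<Omega> j" "u1 \<in> dom_powA \<Omega> (j - 1/2)" "variational_solution \<Omega> \<alpha> \<beta> u0 u1 u u'"
      "0 < \<delta>" "\<delta> \<le> (\<alpha>min + \<beta>min * lam1) / 2" "\<delta> \<le> lam1 / (\<alpha>max + \<beta>max * lam1)" "0 \<le> t"
    for j \<delta> t u0 u1 u u'
    by (rule energy_decay[of \<alpha>min \<alpha> \<alpha>max \<beta>min \<beta> \<beta>max \<alpha>' \<beta>' u0 j u1 u u' \<delta> K t]; fact assms that K_def)+
  show ?thesis
  \<comment> \<open>The second constant is doubled because the energy carries the factor 1/2 in
    front of the velocity norm.\<close>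
  proof (rule conjI[OF exI[of _ "4 + 2 * K"] exI[of _ "2 * (4 + 2 * K)"]]; intro conjI)
    show "\<forall>j \<delta> u0 u1 u u'.
           j \<ge> 1/2 \<and> u0 \<in> dom_powA \<Omega> j \<and> u1 \<in> dom_powA \<Omega> (j - 1/2) \<and>
           variational_solution \<Omega> \<alpha> \<beta> u0 u1 u u' \<and>
           (0 < \<delta> \<and> \<delta> < min ((\<alpha>min + \<beta>min * lam1) / 2) (lam1 / (\<alpha>max + \<beta>max * lam1)) \<or>
            0 < \<delta> \<and> \<delta> = (\<alpha>min + \<beta>min * lam1) / 2 \<and> \<delta> \<le> lam1 / (\<alpha>max + \<beta>max * lam1)) \<longrightarrow>
           (\<forall>t\<ge>0. u t \<in> dom_powA \<Omega> j \<and> u' t \<in> dom_powA \<Omega> (j - 1/2) \<and>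
                  energyA \<Omega> j u u' t \<le> (4 + 2 * K) * exp (- 2 * \<delta> * t) * energyA \<Omega> j u u' 0)"
    proof (intro allI impI, elim conjE)
      fix j \<delta> t :: real and u0 u1 u u'
      assume "u0 \<in> dom_powA \<Omega> j" "u1 \<in> dom_powA \<Omega> (j - 1/2)"
        "variational_solution \<Omega> \<alpha> \<beta> u0 u1 u u'"
      note decay = decay[OF this]
      assume \<delta>: "0 < \<delta> \<and> \<delta> < min ((\<alpha>min + \<beta>min * lam1) / 2) (lam1 / (\<alpha>max + \<beta>max * lam1)) \<or>
            0 < \<delta> \<and> \<delta> = (\<alpha>min + \<beta>min * lam1) / 2 \<and> \<delta> \<le> lam1 / (\<alpha>max + \<beta>max * lam1)"
      then have "0 < \<delta>" "\<delta> \<le> (\<alpha>min + \<beta>min * lam1) / 2" "\<delta> \<le> lam1 / (\<alpha>max + \<beta>max * lam1)" by auto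
      note decay = decay[OF this]
      assume "0 \<le> t"
      then show "u t \<in> dom_powA \<Omega> j \<and> u' t \<in> dom_powA \<Omega> (j - 1/2) \<and>
          energyA \<Omega> j u u' t \<le> (4 + 2 * K) * exp (- 2 * \<delta> * t) * energyA \<Omega> j u u' 0"
        by (intro conjI decay)
    qed
    show "\<forall>j \<delta> u0 u1 u u'.
           j \<ge> 1/2 \<and> u0 \<in> dom_powA \<Omega> j \<and> u1 \<in> dom_powA \<Omega> (j - 1/2) \<and>
           variational_solution \<Omega> \<alpha> \<beta> u0 u1 u u' \<and>
           0 < \<delta> \<and> \<delta> = lam1 / (\<alpha>max + \<beta>max * lam1) \<and> \<delta> \<le> (\<alpha>min + \<beta>min * lam1) / 2 \<longrightarrow>
           (\<forall>t\<ge>0. u' t \<in> dom_powA \<Omega> (j - 1/2) \<and>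
                  (normA \<Omega> (2*j - 1) (u' t))\<^sup>2 \<le> 2 * (4 + 2 * K) * exp (- 2 * \<delta> * t) * energyA \<Omega> j u u' 0)"
    proof (intro allI impI, elim conjE)
      fix j \<delta> t :: real and u0 u1 u u'
      assume "u0 \<in> dom_powA \<Omega> j" "u1 \<in> dom_powA \<Omega> (j - 1/2)"
        "variational_solution \<Omega> \<alpha> \<beta> u0 u1 u u'"
      note decay = decay[OF this]
      assume "0 < \<delta>" "\<delta> \<le> (\<alpha>min + \<beta>min * lam1) / 2" "\<delta> = lam1 / (\<alpha>max + \<beta>max * lam1)"
      note decay = decay[OF this(1,2) eq_refl[OF this(3)]]
      assume t: "0 \<le> t"
      have "(normA \<Omega> (2*j - 1) (u' t))\<^sup>2 \<le> 2 * energyA \<Omega> j u u' t" by (simp add: energyA_def)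
      also have "\<dots> \<le> 2 * ((4 + 2 * K) * exp (- 2 * \<delta> * t) * energyA \<Omega> j u u' 0)"
        using decay(3)[OF t] by simp
      finally have "(normA \<Omega> (2*j - 1) (u' t))\<^sup>2
          \<le> 2 * (4 + 2 * K) * exp (- 2 * \<delta> * t) * energyA \<Omega> j u u' 0"
        by (simp only: mult.assoc)
      with decay(2)[OF t] show "u' t \<in> dom_powA \<Omega> (j - 1/2) \<and> (normA \<Omega> (2*j - 1) (u' t))\<^sup>2
          \<le> 2 * (4 + 2 * K) * exp (- 2 * \<delta> * t) * energyA \<Omega> j u u' 0" ..
    qed
  qed (use \<open>0 \<le> K\<close> in auto)
qed

end
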